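(* Let $(\mathcal{X},d_{\mathcal{X}})$ and $(\mathcal{Y},d_{\mathcal{Y}})$ be cochain complexes of complete nuclear $DF$-spaces and continuous linear operators, and let $\varphi:\mathcal{X}\to\mathcal{Y}$ be a continuous morphism of complexes. Suppose that $\varphi_*=H^n(\varphi):H^n(\mathcal{X},d_{\mathcal{X}})\to H^n(\mathcal{Y},d_{\mathcal{Y}})$ is surjective. Then $\varphi_*$ is open.
   Context: A $DF$-space is a locally convex space with a countable fundamental system of bounded sets in which every bornivorous countable intersection of closed absolutely convex neighbourhoods of $0$ is a neighbourhood of $0$. A continuous morphism of complexes is a family of continuous linear operators commuting with the differentials. $H^n$ denotes kernel modulo image at degree $n$, with the quotient topology (of the subspace topology on the kernel); it need not be Hausdorff. The degree $n$ is fixed. *)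

theory Defs
  imports "HOL-Analysis.Analysis" "HOL-Library.Function_Algebras"
begin

text \<open>
  A topological vector space is given by a topology \<open>T\<close> on a type \<open>'a\<close> that carries a vector
  space structure \<open>scale\<close> over \<open>'k\<close>; the space itself is the linear subspace \<open>topspace T\<close> with
  the inherited operations.  In this way one type can host all the spaces of a complex, each with
  its own topology; for an arbitrary family of spaces take \<open>'a\<close> to be their direct sum.
  The scalar class \<open>real_normed_field\<close> is, by the Gelfand-Mazur theorem, inhabited precisely by
  the real and the complex numbers up to isometric isomorphism.
\<close>

section \<open>Locally convex spaces\<close>

definition linear_on ::
  "('k \<Rightarrow> 'a::ab_group_add \<Rightarrow> 'a) \<Rightarrow> ('k \<Rightarrow> 'b::ab_group_add \<Rightarrow> 'b) \<Rightarrow> 'a set \<Rightarrow> ('a \<Rightarrow> 'b) \<Rightarrow> bool"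
  where "linear_on s t E f \<longleftrightarrow>
    (\<forall>x\<in>E. \<forall>y\<in>E. f (x + y) = f x + f y) \<and> (\<forall>a. \<forall>x\<in>E. f (s a x) = t a (f x))"

definition absolutely_convex :: "('k::real_normed_field \<Rightarrow> 'a::ab_group_add \<Rightarrow> 'a) \<Rightarrow> 'a set \<Rightarrow> bool"
  where "absolutely_convex s C \<longleftrightarrow>
    (\<forall>x\<in>C. \<forall>y\<in>C. \<forall>a b. norm a + norm b \<le> 1 \<longrightarrow> s a x + s b y \<in> C)"

definition zero_nbhd :: "'a::zero topology \<Rightarrow> 'a set \<Rightarrow> bool"
  where "zero_nbhd T U \<longleftrightarrow> U \<subseteq> topspace T \<and> (\<exists>V. openin T V \<and> 0 \<in> V \<and> V \<subseteq> U)"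

definition absorbs :: "('k::real_normed_field \<Rightarrow> 'a \<Rightarrow> 'a) \<Rightarrow> 'a set \<Rightarrow> 'a set \<Rightarrow> bool"
  where "absorbs s U B \<longleftrightarrow> (\<exists>r>0. \<forall>a. r \<le> norm a \<longrightarrow> B \<subseteq> s a ` U)"

text \<open>The separation axiom is part of the notion of a locally convex space.\<close>

locale locally_convex_space = vector_space scale
  for scale :: "'k::real_normed_field \<Rightarrow> 'a::ab_group_add \<Rightarrow> 'a" +
  fixes T :: "'a topology"
  assumes subspace_topspace: "module.subspace scale (topspace T)"
    and continuous_add: "continuous_map (prod_topology T T) T (\<lambda>(x, y). x + y)"
    and continuous_scale: "continuous_map (prod_topology euclidean T) T (\<lambda>(a, x). scale a x)"
    and locally_convex: "zero_nbhd T U \<Longrightarrow> \<exists>V\<subseteq>U. zero_nbhd T V \<and> absolutely_convex scale V"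
    and hausdorff: "Hausdorff_space T"

definition tvs_bounded :: "('k::real_normed_field \<Rightarrow> 'a::zero \<Rightarrow> 'a) \<Rightarrow> 'a topology \<Rightarrow> 'a set \<Rightarrow> bool"
  where "tvs_bounded s T B \<longleftrightarrow> B \<subseteq> topspace T \<and> (\<forall>U. zero_nbhd T U \<longrightarrow> absorbs s U B)"

definition bornivorous :: "('k::real_normed_field \<Rightarrow> 'a::zero \<Rightarrow> 'a) \<Rightarrow> 'a topology \<Rightarrow> 'a set \<Rightarrow> bool"
  where "bornivorous s T U \<longleftrightarrow> (\<forall>B. tvs_bounded s T B \<longrightarrow> absorbs s U B)"

definition DF_space :: "('k::real_normed_field \<Rightarrow> 'a::ab_group_add \<Rightarrow> 'a) \<Rightarrow> 'a topology \<Rightarrow> bool"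
  where "DF_space s T \<longleftrightarrow> locally_convex_space s T \<and>
    (\<exists>B :: nat \<Rightarrow> 'a set. (\<forall>i. tvs_bounded s T (B i)) \<and> (\<forall>C. tvs_bounded s T C \<longrightarrow> (\<exists>i. C \<subseteq> B i))) \<and>
    (\<forall>V :: nat \<Rightarrow> 'a set.
       (\<forall>i. zero_nbhd T (V i) \<and> closedin T (V i) \<and> absolutely_convex s (V i)) \<and>
       bornivorous s T (\<Inter>i. V i) \<longrightarrow> zero_nbhd T (\<Inter>i. V i))"

definition tvs_complete :: "'a::ab_group_add topology \<Rightarrow> bool"
  where "tvs_complete T \<longleftrightarrow>
    (\<forall>F. F \<noteq> bot \<and> eventually (\<lambda>x. x \<in> topspace T) F \<and>
         (\<forall>U. zero_nbhd T U \<longrightarrow> (\<exists>A. eventually (\<lambda>x. x \<in> A) F \<and> (\<forall>x\<in>A. \<forall>y\<in>A. x - y \<in> U)))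
       \<longrightarrow> (\<exists>l. limitin T (\<lambda>x. x) l F))"


section \<open>Nuclear spaces\<close>

definition continuous_seminorm ::
  "('k::real_normed_field \<Rightarrow> 'a::ab_group_add \<Rightarrow> 'a) \<Rightarrow> 'a topology \<Rightarrow> ('a \<Rightarrow> real) \<Rightarrow> bool"
  where "continuous_seminorm s T p \<longleftrightarrow> continuous_map T euclideanreal p \<and>
    (\<forall>x\<in>topspace T. 0 \<le> p x) \<and>
    (\<forall>x\<in>topspace T. \<forall>y\<in>topspace T. p (x + y) \<le> p x + p y) \<and>
    (\<forall>a. \<forall>x\<in>topspace T. p (s a x) = norm a * p x)"

text \<open>
  The completion of the normed space \<open>E / ker p\<close> is represented, before dividing out the kernel
  of the seminorm, by the \<open>p\<close>-Cauchy sequences in \<open>E\<close> with pointwise operations and the seminorm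
  \<open>lim p (z j)\<close>.
\<close>

definition completion :: "'a::ab_group_add set \<Rightarrow> ('a \<Rightarrow> real) \<Rightarrow> (nat \<Rightarrow> 'a) set"
  where "completion E p =
    {z. (\<forall>j. z j \<in> E) \<and> (\<forall>e>0. \<exists>N. \<forall>i\<ge>N. \<forall>j\<ge>N. p (z i - z j) < e)}"

definition completion_seminorm :: "('a \<Rightarrow> real) \<Rightarrow> (nat \<Rightarrow> 'a) \<Rightarrow> real"
  where "completion_seminorm p z = lim (\<lambda>j. p (z j))"

definition pointwise_scale :: "('k \<Rightarrow> 'a \<Rightarrow> 'a) \<Rightarrow> 'k \<Rightarrow> (nat \<Rightarrow> 'a) \<Rightarrow> nat \<Rightarrow> 'a"
  where "pointwise_scale s a z = (\<lambda>j. s a (z j))"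

text \<open>
  \<open>u x = (\<Sum>k. c k f\<^sub>k(x) y\<^sub>k)\<close> with \<open>c\<close> absolutely summable and \<open>f\<^sub>k\<close>, \<open>y\<^sub>k\<close> in the unit balls of the
  dual of \<open>(E, q)\<close> and of \<open>(F, p)\<close>.  All data are compatible with passing to the quotients by the
  kernels of \<open>q\<close> and \<open>p\<close>.
\<close>

definition nuclear_operator ::
  "('k::real_normed_field \<Rightarrow> 'a::ab_group_add \<Rightarrow> 'a) \<Rightarrow> 'a set \<Rightarrow> ('a \<Rightarrow> real) \<Rightarrow>
   ('k \<Rightarrow> 'b::ab_group_add \<Rightarrow> 'b) \<Rightarrow> 'b set \<Rightarrow> ('b \<Rightarrow> real) \<Rightarrow> ('a \<Rightarrow> 'b) \<Rightarrow> bool"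
  where "nuclear_operator s E q t F p u \<longleftrightarrow>
    (\<exists>(c :: nat \<Rightarrow> 'k) (f :: nat \<Rightarrow> 'a \<Rightarrow> 'k) (y :: nat \<Rightarrow> 'b).
       summable (\<lambda>k. norm (c k)) \<and>
       (\<forall>k. linear_on s (*) E (f k) \<and> (\<forall>x\<in>E. norm (f k x) \<le> q x)) \<and>
       (\<forall>k. y k \<in> F \<and> p (y k) \<le> 1) \<and>
       (\<forall>x\<in>E. (\<lambda>N. p (u x - (\<Sum>k<N. t (c k * f k x) (y k)))) \<longlonglongrightarrow> 0))"

text \<open>
  For \<open>p \<le> q\<close> every \<open>q\<close>-Cauchy sequence is \<open>p\<close>-Cauchy, and the canonical map between the
  completions sends the class of a sequence to the class of the same sequence.
\<close>

definition nuclear_space :: "('k::real_normed_field \<Rightarrow> 'a::ab_group_add \<Rightarrow> 'a) \<Rightarrow> 'a topology \<Rightarrow> bool"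
  where "nuclear_space s T \<longleftrightarrow> locally_convex_space s T \<and>
    (\<forall>p. continuous_seminorm s T p \<longrightarrow>
      (\<exists>q. continuous_seminorm s T q \<and> (\<forall>x\<in>topspace T. p x \<le> q x) \<and>
        nuclear_operator
          (pointwise_scale s) (completion (topspace T) q) (completion_seminorm q)
          (pointwise_scale s) (completion (topspace T) p) (completion_seminorm p)
          (\<lambda>z. z)))"

definition complete_nuclear_DF_space ::
  "('k::real_normed_field \<Rightarrow> 'a::ab_group_add \<Rightarrow> 'a) \<Rightarrow> 'a topology \<Rightarrow> bool"
  where "complete_nuclear_DF_space s T \<longleftrightarrow> DF_space s T \<and> nuclear_space s T \<and> tvs_complete T"


section \<open>Complexes and their cohomology\<close>

definition continuous_linear ::
  "('k \<Rightarrow> 'a::ab_group_add \<Rightarrow> 'a) \<Rightarrow> ('k \<Rightarrow> 'b::ab_group_add \<Rightarrow> 'b) \<Rightarrow>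
   'a topology \<Rightarrow> 'b topology \<Rightarrow> ('a \<Rightarrow> 'b) \<Rightarrow> bool"
  where "continuous_linear s t T T' f \<longleftrightarrow> continuous_map T T' f \<and> linear_on s t (topspace T) f"

definition cochain_complex ::
  "('k::real_normed_field \<Rightarrow> 'a::ab_group_add \<Rightarrow> 'a) \<Rightarrow> (int \<Rightarrow> 'a topology) \<Rightarrow> (int \<Rightarrow> 'a \<Rightarrow> 'a) \<Rightarrow> bool"
  where "cochain_complex s X d \<longleftrightarrow>
    (\<forall>k. locally_convex_space s (X k)) \<and>
    (\<forall>k. continuous_linear s s (X k) (X (k + 1)) (d k)) \<and>
    (\<forall>k. \<forall>x\<in>topspace (X k). d (k + 1) (d k x) = 0)"

definition cochain_morphism ::
  "('k \<Rightarrow> 'a::ab_group_add \<Rightarrow> 'a) \<Rightarrow> (int \<Rightarrow> 'a topology) \<Rightarrow> (int \<Rightarrow> 'a \<Rightarrow> 'a) \<Rightarrow>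
   ('k \<Rightarrow> 'b::ab_group_add \<Rightarrow> 'b) \<Rightarrow> (int \<Rightarrow> 'b topology) \<Rightarrow> (int \<Rightarrow> 'b \<Rightarrow> 'b) \<Rightarrow>
   (int \<Rightarrow> 'a \<Rightarrow> 'b) \<Rightarrow> bool"
  where "cochain_morphism s X dX t Y dY \<phi> \<longleftrightarrow>
    (\<forall>k. continuous_linear s t (X k) (Y k) (\<phi> k)) \<and>
    (\<forall>k. \<forall>x\<in>topspace (X k). dY k (\<phi> k x) = \<phi> (k + 1) (dX k x))"

definition cocycles :: "(int \<Rightarrow> 'a::zero topology) \<Rightarrow> (int \<Rightarrow> 'a \<Rightarrow> 'a) \<Rightarrow> int \<Rightarrow> 'a set"
  where "cocycles X d n = {x \<in> topspace (X n). d n x = 0}"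

definition coboundaries :: "(int \<Rightarrow> 'a topology) \<Rightarrow> (int \<Rightarrow> 'a \<Rightarrow> 'a) \<Rightarrow> int \<Rightarrow> 'a set"
  where "coboundaries X d n = d (n - 1) ` topspace (X (n - 1))"

definition cohomology_class ::
  "(int \<Rightarrow> 'a::ab_group_add topology) \<Rightarrow> (int \<Rightarrow> 'a \<Rightarrow> 'a) \<Rightarrow> int \<Rightarrow> 'a \<Rightarrow> 'a set"
  where "cohomology_class X d n x = (\<lambda>b. x + b) ` coboundaries X d n"

definition quotient_topology :: "'a topology \<Rightarrow> ('a \<Rightarrow> 'b) \<Rightarrow> 'b topology"
  where "quotient_topology T f =
    topology (\<lambda>U. U \<subseteq> f ` topspace T \<and> openin T {x \<in> topspace T. f x \<in> U})"

lemma openin_quotient_topology: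
  "openin (quotient_topology T f) U \<longleftrightarrow> U \<subseteq> f ` topspace T \<and> openin T {x \<in> topspace T. f x \<in> U}"
proof -
  have "istopology (\<lambda>U. U \<subseteq> f ` topspace T \<and> openin T {x \<in> topspace T. f x \<in> U})"
    unfolding istopology_def
  proof (intro conjI allI impI)
    fix S V
    assume *: "S \<subseteq> f ` topspace T \<and> openin T {x \<in> topspace T. f x \<in> S}"
      "V \<subseteq> f ` topspace T \<and> openin T {x \<in> topspace T. f x \<in> V}"
    then show "S \<inter> V \<subseteq> f ` topspace T" by blast
    have "{x \<in> topspace T. f x \<in> S \<inter> V} =
      {x \<in> topspace T. f x \<in> S} \<inter> {x \<in> topspace T. f x \<in> V}" by blast
    then show "openin T {x \<in> topspace T. f x \<in> S \<inter> V}" using * by auto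
  next
    fix K
    assume *: "\<forall>V\<in>K. V \<subseteq> f ` topspace T \<and> openin T {x \<in> topspace T. f x \<in> V}"
    then show "\<Union>K \<subseteq> f ` topspace T" by blast
    have "{x \<in> topspace T. f x \<in> \<Union>K} = (\<Union>V\<in>K. {x \<in> topspace T. f x \<in> V})" by blast
    then show "openin T {x \<in> topspace T. f x \<in> \<Union>K}" using * by auto
  qed
  then show ?thesis by (simp add: quotient_topology_def)
qed

lemma topspace_quotient_topology [simp]: "topspace (quotient_topology T f) = f ` topspace T"
proof -
  have "{x \<in> topspace T. f x \<in> f ` topspace T} = topspace T" by blast
  then have "openin (quotient_topology T f) (f ` topspace T)"
    by (simp add: openin_quotient_topology)
  then show ?thesis
    by (metis openin_quotient_topology openin_subset openin_topspace subset_antisym)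
qed

lemma quotient_map_quotient_topology: "quotient_map T (quotient_topology T f) f"
  by (auto simp: quotient_map_def openin_quotient_topology)

definition cohomology :: "(int \<Rightarrow> 'a::ab_group_add topology) \<Rightarrow> (int \<Rightarrow> 'a \<Rightarrow> 'a) \<Rightarrow> int \<Rightarrow> 'a set topology"
  where "cohomology X d n =
    quotient_topology (subtopology (X n) (cocycles X d n)) (cohomology_class X d n)"

lemma topspace_cohomology: "topspace (cohomology X d n) = cohomology_class X d n ` cocycles X d n"
  by (simp add: cohomology_def cocycles_def Int_def)

text \<open>
  The map induced on \<open>H\<^sup>n\<close>: for a morphism of complexes the union is over equal sets, see
  \<open>cohomology_map_class\<close>.
\<close>

definition cohomology_map ::
  "(int \<Rightarrow> 'b::ab_group_add topology) \<Rightarrow> (int \<Rightarrow> 'b \<Rightarrow> 'b) \<Rightarrow> (int \<Rightarrow> 'a \<Rightarrow> 'b) \<Rightarrow> int \<Rightarrow> 'a set \<Rightarrow> 'b set"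
  where "cohomology_map Y dY \<phi> n c = (\<Union>x\<in>c. cohomology_class Y dY n (\<phi> n x))"

lemma cohomology_map_class:
  assumes X: "cochain_complex s X dX" and Y: "cochain_complex t Y dY"
    and \<phi>: "cochain_morphism s X dX t Y dY \<phi>" and x: "x \<in> cocycles X dX n"
  shows "cohomology_map Y dY \<phi> n (cohomology_class X dX n x) = cohomology_class Y dY n (\<phi> n x)"
    and "\<phi> n x \<in> cocycles Y dY n"
proof -
  interpret LX: locally_convex_space s "X k" for k using X by (simp add: cochain_complex_def)
  interpret LY: locally_convex_space t "Y k" for k using Y by (simp add: cochain_complex_def)
  have lin: "linear_on s t (topspace (X k)) (\<phi> k)"
    and map: "\<phi> k ` topspace (X k) \<subseteq> topspace (Y k)" for k
    using \<phi> by (auto simp: cochain_morphism_def continuous_linear_def continuous_map_def)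
  have dX: "linear_on s s (topspace (X k)) (dX k)"
    and dX_map: "dX k ` topspace (X k) \<subseteq> topspace (X (k + 1))" for k
    using X by (auto simp: cochain_complex_def continuous_linear_def continuous_map_def)
  have dY: "linear_on t t (topspace (Y k)) (dY k)"
    and dY_map: "dY k ` topspace (Y k) \<subseteq> topspace (Y (k + 1))" for k
    using Y by (auto simp: cochain_complex_def continuous_linear_def continuous_map_def)
  have comm: "dY k (\<phi> k w) = \<phi> (k + 1) (dX k w)" if "w \<in> topspace (X k)" for k w
    using \<phi> that by (auto simp: cochain_morphism_def)
  have xT: "x \<in> topspace (X n)" "dX n x = 0" using x by (auto simp: cocycles_def)
  have zero: "0 \<in> topspace (X k)" for k
    using LX.subspace_topspace LX.subspace_0 by blast
  have "\<phi> (n + 1) 0 = 0"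
    using lin[of "n + 1"] zero[of "n + 1"] unfolding linear_on_def by (metis add_cancel_left_left)
  then show "\<phi> n x \<in> cocycles Y dY n"
    using comm[OF xT(1)] xT map by (auto simp: cocycles_def)
  have eq: "cohomology_class Y dY n (\<phi> n (x + dX (n - 1) w)) = cohomology_class Y dY n (\<phi> n x)"
    if w: "w \<in> topspace (X (n - 1))" for w
  proof -
    let ?v = "\<phi> (n - 1) w" and ?S = "topspace (Y (n - 1))"
    have v: "?v \<in> ?S" using map w by blast
    have "dX (n - 1) w \<in> topspace (X n)" using dX_map[of "n - 1"] w by auto
    then have a: "\<phi> n (x + dX (n - 1) w) = \<phi> n x + dY (n - 1) ?v"
      using lin[of n] xT comm[OF w] by (auto simp: linear_on_def)
    have add: "dY (n - 1) (u + u') = dY (n - 1) u + dY (n - 1) u'" if "u \<in> ?S" "u' \<in> ?S" for u u'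
      using dY[of "n - 1"] that by (auto simp: linear_on_def)
    have plus: "?v + u \<in> ?S" and minus: "u - ?v \<in> ?S" if "u \<in> ?S" for u
      using that v LY.subspace_topspace LY.subspace_add LY.subspace_diff by blast+
    have "(\<lambda>b. dY (n - 1) ?v + b) ` (dY (n - 1) ` ?S) = dY (n - 1) ` ?S"
    proof (intro equalityI subsetI)
      fix z assume "z \<in> (\<lambda>b. dY (n - 1) ?v + b) ` (dY (n - 1) ` ?S)"
      then obtain u where u: "u \<in> ?S" "z = dY (n - 1) ?v + dY (n - 1) u" by blast
      then show "z \<in> dY (n - 1) ` ?S" using add[OF v] plus by (metis imageI)
    next
      fix z assume "z \<in> dY (n - 1) ` ?S"
      then obtain u where u: "u \<in> ?S" "z = dY (n - 1) u" by blast
      then have "z = dY (n - 1) ?v + dY (n - 1) (u - ?v)"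
        using add[OF v minus] by simp
      then show "z \<in> (\<lambda>b. dY (n - 1) ?v + b) ` (dY (n - 1) ` ?S)" using minus u by blast
    qed
    moreover have "cohomology_class Y dY n (\<phi> n x + dY (n - 1) ?v) =
      (\<lambda>b. \<phi> n x + b) ` ((\<lambda>b. dY (n - 1) ?v + b) ` (dY (n - 1) ` ?S))"
      by (simp add: cohomology_class_def coboundaries_def image_image add.assoc)
    ultimately show ?thesis
      by (simp add: a cohomology_class_def coboundaries_def)
  qed
  then show "cohomology_map Y dY \<phi> n (cohomology_class X dX n x) = cohomology_class Y dY n (\<phi> n x)"
    using zero[of "n - 1"]
    unfolding cohomology_map_def cohomology_class_def[of X] coboundaries_def[of X] by auto
qed

end

theory Submission
  imports Defs
begin

text \<open>
  A surjective continuous linear map between the spaces at hand is open by an open mapping theorem,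
  and the statement is reduced to this case: surjectivity of \<open>\<phi>\<^sub>*\<close> on \<open>H\<^sup>n\<close> means that the map
  \<open>(x, y) \<mapsto> \<phi> x + dY y\<close> from \<open>Z\<^sup>n(X) \<times> Y\<^sup>n\<^sup>-\<^sup>1\<close> to \<open>Z\<^sup>n(Y)\<close> is onto.  If it is a quotient map
  (\<open>sum_map_quotient_map\<close>), then for an open set \<open>U\<close> of \<open>H\<^sup>n(X)\<close> the set of cocycles of \<open>Y\<close> whose class
  lies in \<open>\<phi>\<^sub>* U\<close> is open, since its preimage is a union of translates of the open set of cocycles of \<open>X\<close>
  with class in \<open>U\<close>, times the second factor.

  The quotient property rests on two facts about a complete nuclear \<open>DF\<close>-space.

  First, it is exhausted by a sequence of compact absolutely convex sets that swallow all bounded sets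
  (\<open>compact_exhaustion\<close>).  Indeed nuclearity approximates the canonical maps between the normed spaces
  of seminorms by finite rank operators, so bounded sets are precompact.  This uses that bounded sets
  of scalars are precompact, which for an abstract normed field is the content of the Gelfand-Mazur
  theorem (\<open>real_quadratic_root\<close>, \<open>bounded_scalars_in_compact\<close>).

  Second, its topology is compactly generated (\<open>complete_nuclear_DF_imp_k_space\<close>): a set containing \<open>0\<close>
  that is relatively open in each compact set contains a countable intersection of closed absolutely
  convex neighbourhoods which is bornivorous.  Compact generation is inherited by the closed subspace
  \<open>Z\<^sup>n(Y)\<close>, whereas the \<open>DF\<close> property and bornologicity in general need not pass to closed subspaces.

  Therefore it suffices to lift compact sets.  The space \<open>Z\<^sup>n(Y)\<close> is the union of the images of the
  exhausting compact sets of the domain, and Baire's theorem inside a compact absolutely convex set of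
  \<open>Z\<^sup>n(Y)\<close> shows that a multiple of one image contains it (\<open>compact_absorbed_by_cover\<close>).
\<close>


section \<open>Normed fields over the reals are locally compact\<close>

text \<open>
  If \<open>'k\<close> is embedded in a field containing \<open>\<i>\<close>, the element \<open>(u - c) (u - cnj c)\<close> lies in
  \<open>'k\<close>, and this is its norm.  It serves as a multiplicative substitute for the squared distance
  from \<open>u\<close> to the complex number \<open>c\<close> and is available even if \<open>'k\<close> has no square root of \<open>-1\<close>.
\<close>

definition quadratic_norm :: "'k::real_normed_field \<Rightarrow> complex \<Rightarrow> real"
  where "quadratic_norm u c = norm ((u - of_real (Re c))\<^sup>2 + of_real ((Im c)\<^sup>2))"

lemma quadratic_norm_nonneg [simp]: "0 \<le> quadratic_norm u c"
  by (simp add: quadratic_norm_def)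

lemma quadratic_norm_shift: "quadratic_norm (u + of_real b) c = quadratic_norm u (c - of_real b)"
  by (simp add: quadratic_norm_def algebra_simps)

text \<open>
  The factorisation \<open>u\<^sup>2 - s\<^sup>2 = (u - s) (u + s)\<close>, multiplied by its conjugate.
\<close>

lemma quadratic_norm_square:
  "quadratic_norm (u\<^sup>2) (s\<^sup>2) = quadratic_norm u s * quadratic_norm u (- s)"
proof -
  obtain p q where s: "s = Complex p q" by (cases s)
  have "((u\<^sup>2 - of_real (p\<^sup>2 - q\<^sup>2))\<^sup>2 + of_real ((2 * p * q)\<^sup>2)) =
     ((u - of_real p)\<^sup>2 + of_real (q\<^sup>2)) * ((u + of_real p)\<^sup>2 + of_real (q\<^sup>2))"
    by (simp add: algebra_simps power2_eq_square)
  then have "norm ((u\<^sup>2 - of_real (p\<^sup>2 - q\<^sup>2))\<^sup>2 + of_real ((2 * p * q)\<^sup>2)) =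
     norm ((u - of_real p)\<^sup>2 + of_real (q\<^sup>2)) * norm ((u + of_real p)\<^sup>2 + of_real (q\<^sup>2))"
    by (simp add: norm_mult)
  then show ?thesis
    by (simp add: quadratic_norm_def s power2_eq_square algebra_simps)
qed

text \<open>
  Expanding the square shows that \<open>quadratic_norm x c\<close> grows like \<open>\<bar>c\<bar>\<^sup>2\<close>, so the infimum over a large
  disc, which compactness attains, is the infimum over the plane.
\<close>

lemma quadratic_norm_attains_inf:
  fixes x :: "'k::real_normed_field"
  obtains c0 where "\<And>c. quadratic_norm x c0 \<le> quadratic_norm x c"
proof -
  let ?R = "3 * norm x + 1"
  have cont: "continuous_on (cball 0 ?R) (quadratic_norm x)"
    unfolding quadratic_norm_def by (intro continuous_intros)
  obtain c0 where c0: "c0 \<in> cball 0 ?R" "\<And>c. c \<in> cball 0 ?R \<Longrightarrow> quadratic_norm x c0 \<le> quadratic_norm x c"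
    using continuous_attains_inf[OF compact_cball _ cont]
    by (metis add_nonneg_nonneg cball_eq_empty mult_nonneg_nonneg norm_ge_zero not_le zero_le_numeral zero_le_one)
  have "quadratic_norm x c0 \<le> quadratic_norm x c" for c
  proof (cases "c \<in> cball 0 ?R")
    case False
    let ?r = "cmod c"
    have r: "?r > 3 * norm x + 1" using False by simp
    have "(x - of_real (Re c))\<^sup>2 + of_real ((Im c)\<^sup>2) = of_real (?r\<^sup>2) - (of_real (2 * Re c) * x - x\<^sup>2)"
      unfolding cmod_power2 by (simp add: algebra_simps power2_eq_square)
    then have "quadratic_norm x c \<ge> norm (of_real (?r\<^sup>2) :: 'k) - norm (of_real (2 * Re c) * x - x\<^sup>2)"
      unfolding quadratic_norm_def by (metis norm_triangle_ineq2)
    moreover have "norm (of_real (2 * Re c) * x - x\<^sup>2) \<le> 2 * \<bar>Re c\<bar> * norm x + (norm x)\<^sup>2"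
      using norm_triangle_ineq4[of "of_real (2 * Re c) * x" "x\<^sup>2"] by (simp add: norm_mult norm_power abs_mult)
    moreover have "2 * \<bar>Re c\<bar> * norm x \<le> 2 * ?r * norm x"
      using abs_Re_le_cmod[of c] by (simp add: mult_right_mono)
    ultimately have "quadratic_norm x c \<ge> ?r\<^sup>2 - 2 * ?r * norm x - (norm x)\<^sup>2" by (simp add: norm_power)
    moreover have "?r\<^sup>2 - 2 * ?r * norm x - (norm x)\<^sup>2 \<ge> (norm x)\<^sup>2"
    proof -
      have "(?r - norm x)\<^sup>2 \<ge> (2 * norm x + 1)\<^sup>2" using r by (intro power_mono) auto
      moreover have "(2 * norm x + 1)\<^sup>2 \<ge> 4 * (norm x)\<^sup>2"
        by (simp add: power2_eq_square algebra_simps)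
      moreover have "?r\<^sup>2 - 2 * ?r * norm x - (norm x)\<^sup>2 = (?r - norm x)\<^sup>2 - 2 * (norm x)\<^sup>2"
        by (simp add: power2_eq_square algebra_simps)
      ultimately show ?thesis using zero_le_power2[of "norm x"] by linarith
    qed
    moreover have "quadratic_norm x c0 \<le> (norm x)\<^sup>2"
      using c0(2)[of 0] by (simp add: quadratic_norm_def norm_power)
    ultimately show ?thesis by linarith
  qed (use c0 in blast)
  then show thesis using that by blast
qed

text \<open>
  The heart of the elementary proof of the Gelfand-Mazur theorem for multiplicative norms.  Put
  \<open>y = (x - a)\<^sup>2 + b\<close>, so \<open>norm y = m\<close>.  Splitting complex numbers by square roots, every
  \<open>quadratic_norm (y ^ 2 ^ k) c\<close> is a product of \<open>2 ^ (k + 1)\<close> values of \<open>quadratic_norm x\<close>, hence at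
  least \<open>(m\<^sup>2) ^ 2 ^ k\<close>.  In the telescoping factorisation of \<open>y ^ 2 ^ k - (- e) ^ 2 ^ k\<close> into \<open>y + e\<close>
  and factors \<open>y ^ 2 ^ j + (- e) ^ 2 ^ j\<close>, all factors but the first therefore have norm at least
  \<open>m ^ 2 ^ j\<close>, while the product has norm at most \<open>m ^ 2 ^ k + e ^ 2 ^ k\<close>.  This forces
  \<open>norm (y + e) \<le> m (1 + (e / m) ^ 2 ^ k)\<close>, and \<open>k\<close> tends to infinity.
\<close>

lemma quadratic_norm_minimum_extends:
  fixes x :: "'k::real_normed_field"
  assumes min: "\<And>c. m \<le> quadratic_norm x c" and b: "0 \<le> b"
    and y: "norm ((x - of_real a)\<^sup>2 + of_real b) = m" and e: "0 \<le> e" "e < m"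
  shows "norm ((x - of_real a)\<^sup>2 + of_real (b + e)) = m"
proof -
  define y where "y = (x - of_real a)\<^sup>2 + of_real b"
  have m: "m > 0" using e by simp
  have lower: "(m\<^sup>2) ^ (2 ^ k) \<le> quadratic_norm (y ^ (2 ^ k)) c" for k c
  proof (induction k arbitrary: c)
    case 0
    define s where "s = csqrt (c - of_real b)"
    have "quadratic_norm y c = quadratic_norm ((x - of_real a)\<^sup>2) (s\<^sup>2)"
      by (simp add: y_def quadratic_norm_shift s_def)
    also have "\<dots> = quadratic_norm x (s + of_real a) * quadratic_norm x (- s + of_real a)"
      unfolding quadratic_norm_square using quadratic_norm_shift[of x "- a"] by simp
    also have "\<dots> \<ge> m * m" using min m by (intro mult_mono) auto
    finally show ?case by (simp add: power2_eq_square)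
  next
    case (Suc k)
    have "quadratic_norm (y ^ (2 ^ Suc k)) c = quadratic_norm ((y ^ (2 ^ k))\<^sup>2) ((csqrt c)\<^sup>2)"
      by (simp add: power_mult[symmetric] mult.commute)
    also have "\<dots> \<ge> (m\<^sup>2) ^ (2 ^ k) * (m\<^sup>2) ^ (2 ^ k)"
      unfolding quadratic_norm_square using Suc by (intro mult_mono) auto
    finally show ?case by (simp add: mult_2 power_add)
  qed
  \<comment> \<open>For a real number \<open>c\<close> the quadratic norm is the square of the distance.\<close>
  have real_lower: "m ^ (2 ^ k) \<le> norm (y ^ (2 ^ k) + of_real t)" for k t
  proof -
    have "(m ^ (2 ^ k))\<^sup>2 \<le> (norm (y ^ (2 ^ k) + of_real t))\<^sup>2"
      using lower[of k "of_real (- t)"]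
      by (simp add: quadratic_norm_def norm_power power_mult[symmetric] mult.commute)
    then show ?thesis by (rule power2_le_imp_le) simp
  qed
  define w where "w = norm (y + of_real e)"
  have "w * m ^ (2 ^ k) \<le> m * norm (y ^ (2 ^ k) - of_real ((- e) ^ (2 ^ k)))" for k
  proof (induction k)
    case 0 then show ?case by (simp add: w_def mult.commute)
  next
    case (Suc k)
    let ?n = "(2::nat) ^ k"
    have "w * m ^ (2 ^ Suc k) = (w * m ^ ?n) * m ^ ?n" by (simp add: mult_2 power_add)
    also have "\<dots> \<le> (m * norm (y ^ ?n - of_real ((- e) ^ ?n))) * norm (y ^ ?n + of_real ((- e) ^ ?n))"
      by (rule mult_mono[OF Suc real_lower]) (use m in auto)
    also have "\<dots> = m * norm ((y ^ ?n - of_real ((- e) ^ ?n)) * (y ^ ?n + of_real ((- e) ^ ?n)))"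
      by (simp add: norm_mult)
    also have "(y ^ ?n - of_real ((- e) ^ ?n)) * (y ^ ?n + of_real ((- e) ^ ?n)) =
        y ^ (2 ^ Suc k) - of_real ((- e) ^ (2 ^ Suc k))"
      by (simp only: power_Suc mult_2 power_add of_real_mult) (simp add: algebra_simps)
    finally show ?case .
  qed
  also have "m * norm (y ^ (2 ^ k) - of_real ((- e) ^ (2 ^ k))) \<le> m * (m ^ (2 ^ k) + e ^ (2 ^ k))" for k
    using norm_triangle_ineq4[of "y ^ (2 ^ k)" "of_real ((- e) ^ (2 ^ k))"] y e m
    by (simp add: norm_power y_def)
  finally have *: "w * m ^ (2 ^ k) \<le> m * (m ^ (2 ^ k) + e ^ (2 ^ k))" for k .
  have "w \<le> m * (1 + (e / m) ^ (2 ^ k))" for k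
    using *[of k] m by (simp add: field_simps power_divide)
  moreover have "(\<lambda>k. m * (1 + (e / m) ^ (2 ^ k))) \<longlonglongrightarrow> m * (1 + 0)"
  proof (intro tendsto_intros)
    have "(\<lambda>n. (e / m) ^ n) \<longlonglongrightarrow> 0" using e m by (intro LIMSEQ_realpow_zero) auto
    moreover have "strict_mono (\<lambda>k. (2::nat) ^ k)" by (simp add: strict_mono_def)
    ultimately show "(\<lambda>k. (e / m) ^ (2 ^ k)) \<longlonglongrightarrow> 0"
      using LIMSEQ_subseq_LIMSEQ by (fastforce simp: o_def)
  qed
  ultimately have "w \<le> m" using LIMSEQ_le_const[of _ "m * (1 + 0)" w] by auto
  moreover have "m \<le> w"
    using min[of "Complex a (sqrt (b + e))"] b e by (simp add: quadratic_norm_def w_def y_def add.assoc)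
  ultimately show ?thesis by (simp add: w_def y_def add.assoc)
qed

text \<open>
  If the minimum \<open>m\<close> of \<open>quadratic_norm x\<close> were positive, then by the preceding lemma the minimal
  value would persist when \<open>b\<close> is increased repeatedly by \<open>m / 2\<close>, although the norm tends to infinity
  with \<open>b\<close>.
\<close>

lemma real_quadratic_root:
  fixes x :: "'k::real_normed_field"
  obtains a b where "0 \<le> b" "(x - of_real a)\<^sup>2 + of_real b = 0"
proof -
  obtain c0 where c0: "\<And>c. quadratic_norm x c0 \<le> quadratic_norm x c"
    using quadratic_norm_attains_inf by blast
  define m a b where "m = quadratic_norm x c0" and "a = Re c0" and "b = (Im c0)\<^sup>2"
  have "m = 0"
  proof (rule ccontr)
    assume "m \<noteq> 0"
    then have m: "m > 0" using quadratic_norm_nonneg[of x c0] unfolding m_def by linarith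
    have all: "norm ((x - of_real a)\<^sup>2 + of_real (b + of_nat j * (m / 2))) = m" for j
    proof (induction j)
      case 0 show ?case by (simp add: m_def a_def b_def quadratic_norm_def)
    next
      case (Suc j)
      have "norm ((x - of_real a)\<^sup>2 + of_real (b + of_nat j * (m / 2) + m / 2)) = m"
        by (rule quadratic_norm_minimum_extends[OF _ _ Suc]) (use c0 m in \<open>auto simp: m_def b_def\<close>)
      moreover have "b + of_nat j * (m / 2) + m / 2 = b + of_nat (Suc j) * (m / 2)"
        by (simp add: field_simps)
      ultimately show ?case by metis
    qed
    obtain j :: nat where j: "of_nat j * (m / 2) > m + norm ((x - of_real a)\<^sup>2)"
      using reals_Archimedean3[of "m / 2"] m by (meson half_gt_zero)
    let ?t = "b + of_nat j * (m / 2)"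
    have "?t \<ge> 0" using m by (simp add: b_def)
    then have "norm (of_real ?t :: 'k) = ?t" by (metis norm_of_real abs_of_nonneg)
    then have "?t - norm ((x - of_real a)\<^sup>2) \<le> m"
      using norm_diff_ineq[of "of_real ?t" "(x - of_real a)\<^sup>2"] all[of j] by (simp add: add.commute)
    moreover have "b \<ge> 0" by (simp add: b_def)
    ultimately show False using j by linarith
  qed
  then show thesis
    using that[of b a] by (simp add: m_def a_def b_def quadratic_norm_def)
qed

text \<open>
  Every scalar has the form \<open>a + \<beta> j\<close> with \<open>a\<close>, \<open>\<beta>\<close> real and a fixed square root \<open>j\<close> of \<open>-1\<close>, if one
  exists; otherwise \<open>\<beta>\<close> is always \<open>0\<close>.  The identity \<open>(a + w) (a - w) = a\<^sup>2 + \<beta>\<^sup>2\<close> for \<open>w = \<plusminus>\<beta> j\<close> bounds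
  \<open>a\<close> and \<open>\<beta>\<close> by twice the norm, so a ball lies in the continuous image of a square.
\<close>

lemma bounded_scalars_in_compact:
  obtains C :: "'k::real_normed_field set" where "compact C" "cball 0 M \<subseteq> C"
proof -
  obtain j :: 'k where j: "(\<exists>i::'k. i\<^sup>2 = -1) \<longrightarrow> j\<^sup>2 = -1"
    by blast
  let ?f = "\<lambda>(a, b). of_real a + of_real b * j"
  let ?I = "{- (2 * M)..2 * M}"
  have "compact (?f ` (?I \<times> ?I))"
    by (intro compact_continuous_image compact_Times compact_Icc)
       (auto simp: case_prod_unfold intro!: continuous_intros)
  moreover have "x \<in> ?f ` (?I \<times> ?I)" if "x \<in> cball 0 M" for x :: 'k
  proof -
    obtain a b where b: "0 \<le> b" and ab: "(x - of_real a)\<^sup>2 + of_real b = 0"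
      using real_quadratic_root by blast
    define w \<beta> where "w = x - of_real a" and "\<beta> = sqrt b"
    have \<beta>: "\<beta> \<ge> 0" "\<beta>\<^sup>2 = b" using b by (auto simp: \<beta>_def)
    have w2: "w\<^sup>2 = - of_real (\<beta>\<^sup>2)" using ab \<beta> by (simp add: w_def eq_neg_iff_add_eq_0)
    then have "(norm w)\<^sup>2 = \<beta>\<^sup>2" by (metis abs_of_nonneg norm_minus_cancel norm_of_real norm_power zero_le_power2)
    then have nw: "norm w = \<beta>" using \<beta>(1) by (simp add: power2_eq_imp_eq)
    have "x * (of_real a - w) = of_real (a\<^sup>2) - w\<^sup>2"
      by (simp add: w_def algebra_simps power2_eq_square)
    also have "\<dots> = of_real (a\<^sup>2 + \<beta>\<^sup>2)" by (simp add: w2)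
    finally have "norm x * norm (of_real a - w) = a\<^sup>2 + \<beta>\<^sup>2"
      by (metis norm_mult norm_of_real abs_of_nonneg sum_power2_ge_zero)
    moreover have "norm (of_real a - w) \<le> \<bar>a\<bar> + \<beta>" using norm_triangle_ineq4[of "of_real a" w] nw by simp
    moreover have nx: "norm x \<le> M" using that by simp
    moreover have "M \<ge> 0" using nx norm_ge_zero[of x] by linarith
    ultimately have "a\<^sup>2 + \<beta>\<^sup>2 \<le> M * (\<bar>a\<bar> + \<beta>)"
      by (metis mult_mono norm_ge_zero)
    moreover have "2 * (a\<^sup>2 + \<beta>\<^sup>2) \<ge> (\<bar>a\<bar> + \<beta>)\<^sup>2"
      using sum_squares_bound[of "\<bar>a\<bar>" \<beta>] by (simp add: power2_sum)
    ultimately have "(\<bar>a\<bar> + \<beta>) * (\<bar>a\<bar> + \<beta>) \<le> 2 * M * (\<bar>a\<bar> + \<beta>)" by (simp add: power2_eq_square)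
    then have le: "\<bar>a\<bar> + \<beta> \<le> 2 * M"
      using \<beta>(1) \<open>M \<ge> 0\<close> by (cases "\<bar>a\<bar> + \<beta> = 0") (auto simp: mult_le_cancel_right)
    have "w = of_real \<beta> * j \<or> w = of_real (- \<beta>) * j"
    proof (cases "\<beta> = 0")
      case True then show ?thesis using nw by simp
    next
      case False
      have "(w / of_real \<beta>)\<^sup>2 = -1" using False by (simp add: power_divide w2)
      then have "w\<^sup>2 = (of_real \<beta> * j)\<^sup>2" using j w2 by (auto simp: power_mult_distrib)
      then show ?thesis by (auto simp: power2_eq_iff)
    qed
    then have "x = ?f (a, \<beta>) \<or> x = ?f (a, - \<beta>)" by (auto simp: w_def algebra_simps)
    moreover have "(a, \<beta>) \<in> ?I \<times> ?I" "(a, - \<beta>) \<in> ?I \<times> ?I" using le \<beta> by auto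
    ultimately show ?thesis by blast
  qed
  ultimately show thesis using that by blast
qed


section \<open>Continuous seminorms and bounded sets\<close>

context locally_convex_space
begin

lemma zero_in [simp]: "0 \<in> topspace T"
  and add_in: "x \<in> topspace T \<Longrightarrow> y \<in> topspace T \<Longrightarrow> x + y \<in> topspace T"
  and diff_in: "x \<in> topspace T \<Longrightarrow> y \<in> topspace T \<Longrightarrow> x - y \<in> topspace T"
  and scale_in: "x \<in> topspace T \<Longrightarrow> scale a x \<in> topspace T"
  and minus_in: "x \<in> topspace T \<Longrightarrow> - x \<in> topspace T"
  by (rule subspace_0[OF subspace_topspace] subspace_add[OF subspace_topspace]
      subspace_diff[OF subspace_topspace] subspace_scale[OF subspace_topspace]
      subspace_neg[OF subspace_topspace]; assumption)+

lemma continuous_map_translation: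
  assumes "x \<in> topspace T" shows "continuous_map T T (\<lambda>y. y + x)"
proof -
  have "continuous_map T (prod_topology T T) (\<lambda>y. (y, x))"
    using assms by (simp add: continuous_map_paired)
  from continuous_map_compose[OF this continuous_add] show ?thesis by (simp add: o_def)
qed

lemma continuous_map_dilation: "continuous_map T T (scale a)"
proof -
  have "continuous_map T (prod_topology euclidean T) (\<lambda>y. (a, y))"
    by (simp add: continuous_map_paired)
  from continuous_map_compose[OF this continuous_scale] show ?thesis by (simp add: o_def)
qed

lemma continuous_map_orbit: "x \<in> topspace T \<Longrightarrow> continuous_map euclidean T (\<lambda>a. scale a x)"
proof -
  assume "x \<in> topspace T"
  then have "continuous_map euclidean (prod_topology euclidean T) (\<lambda>a. (a, x))"
    by (simp add: continuous_map_paired)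
  from continuous_map_compose[OF this continuous_scale] show ?thesis by (simp add: o_def)
qed

abbreviation cseminorm :: "('a \<Rightarrow> real) \<Rightarrow> bool"
  where "cseminorm \<equiv> continuous_seminorm scale T"

lemma cseminorm_nonneg: "cseminorm p \<Longrightarrow> x \<in> topspace T \<Longrightarrow> 0 \<le> p x"
  and cseminorm_add: "cseminorm p \<Longrightarrow> x \<in> topspace T \<Longrightarrow> y \<in> topspace T \<Longrightarrow> p (x + y) \<le> p x + p y"
  and cseminorm_scale: "cseminorm p \<Longrightarrow> x \<in> topspace T \<Longrightarrow> p (scale a x) = norm a * p x"
  and cseminorm_continuous: "cseminorm p \<Longrightarrow> continuous_map T euclideanreal p"
  by (auto simp: continuous_seminorm_def)

lemma cseminorm_zero: "cseminorm p \<Longrightarrow> p 0 = 0"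
  using cseminorm_scale[of p 0 0] by simp

lemma cseminorm_minus: "cseminorm p \<Longrightarrow> x \<in> topspace T \<Longrightarrow> p (- x) = p x"
  using cseminorm_scale[of p x "-1"] by simp

lemma cseminorm_commute:
  "cseminorm p \<Longrightarrow> x \<in> topspace T \<Longrightarrow> y \<in> topspace T \<Longrightarrow> p (x - y) = p (y - x)"
  using cseminorm_minus[of p "x - y"] diff_in by simp

lemma cseminorm_diff:
  "cseminorm p \<Longrightarrow> x \<in> topspace T \<Longrightarrow> y \<in> topspace T \<Longrightarrow> p (x - y) \<le> p x + p y"
  using cseminorm_add[of p x "- y"] minus_in cseminorm_minus[of p y] by simp

lemma cseminorm_triangle:
  "cseminorm p \<Longrightarrow> x \<in> topspace T \<Longrightarrow> y \<in> topspace T \<Longrightarrow> z \<in> topspace T \<Longrightarrow>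
   p (x - z) \<le> p (x - y) + p (y - z)"
  using cseminorm_add[of p "x - y" "y - z"] diff_in by simp

lemma cseminorm_sum:
  assumes "finite I" "\<And>i. i \<in> I \<Longrightarrow> cseminorm (p i)"
  shows "cseminorm (\<lambda>x. \<Sum>i\<in>I. p i x)"
  unfolding continuous_seminorm_def
proof (intro conjI ballI allI)
  show "continuous_map T euclideanreal (\<lambda>x. \<Sum>i\<in>I. p i x)"
    using assms by (intro continuous_map_sum) (auto simp: cseminorm_continuous)
  show "(\<Sum>i\<in>I. p i (x + y)) \<le> (\<Sum>i\<in>I. p i x) + (\<Sum>i\<in>I. p i y)"
    if "x \<in> topspace T" "y \<in> topspace T" for x y
    using assms that by (simp add: sum.distrib[symmetric] sum_mono cseminorm_add)
qed (use assms in \<open>simp_all add: sum_nonneg cseminorm_nonneg sum_distrib_left cseminorm_scale\<close>)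

lemma cseminorm_scaleR:
  assumes "cseminorm p" "0 \<le> c"
  shows "cseminorm (\<lambda>x. c * p x)"
  unfolding continuous_seminorm_def
proof (intro conjI ballI allI)
  show "continuous_map T euclideanreal (\<lambda>x. c * p x)"
    using assms by (intro continuous_map_real_mult) (auto simp: cseminorm_continuous)
  show "c * p (x + y) \<le> c * p x + c * p y" if "x \<in> topspace T" "y \<in> topspace T" for x y
    using mult_left_mono[OF cseminorm_add[OF assms(1) that] assms(2)] by (simp add: distrib_left)
qed (use assms in \<open>simp_all add: cseminorm_nonneg cseminorm_scale\<close>)

lemma openin_seminorm_ball:
  assumes p: "cseminorm p" and x: "x \<in> topspace T"
  shows "openin T {y \<in> topspace T. p (y - x) < r}"
proof -
  have "continuous_map T euclideanreal (p \<circ> (\<lambda>y. y + (- x)))"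
    using continuous_map_compose[OF continuous_map_translation cseminorm_continuous] p minus_in[OF x] by blast
  then have "openin T {y \<in> topspace T. (p \<circ> (\<lambda>y. y + (- x))) y \<in> {..<r}}"
    by (rule openin_continuous_map_preimage) (simp flip: open_openin)
  then show ?thesis by simp
qed

lemma zero_nbhd_seminorm_ball:
  assumes p: "cseminorm p" and r: "0 < r"
  shows "zero_nbhd T {y \<in> topspace T. p y < r}"
  using openin_seminorm_ball[OF p zero_in, of r] r p
  unfolding zero_nbhd_def by (intro conjI exI[of _ "{y \<in> topspace T. p y < r}"]) (auto simp: cseminorm_zero)

text \<open>
  The seminorm is the Minkowski functional of \<open>V\<close>.  For homogeneity under the scalar field, note that
  \<open>V\<close> is invariant under \<open>a / norm a\<close>.
\<close>

lemma gauge_seminorm: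
  assumes V: "zero_nbhd T V" "absolutely_convex scale V"
  obtains p where "cseminorm p" "{x \<in> topspace T. p x < 1} \<subseteq> V"
proof -
  obtain W where W: "openin T W" "0 \<in> W" "W \<subseteq> V" and VE: "V \<subseteq> topspace T"
    using V by (auto simp: zero_nbhd_def)
  define r where "r t = (of_real t :: 'k)" for t
  have conv: "scale a x + scale b y \<in> V" if "x \<in> V" "y \<in> V" "norm a + norm b \<le> 1" for x y a b
    using V(2) that by (auto simp: absolutely_convex_def)
  have bal: "scale a x \<in> V" if "x \<in> V" "norm a \<le> 1" for x a
    using conv[of x x a 0] that by simp
  define S where "S x = {t. t > 0 \<and> scale (r (inverse t)) x \<in> V}" for x
  define p where "p x = Inf (S x)" for x
  have bdd: "bdd_below (S x)" for x by (rule bdd_belowI[of _ 0]) (auto simp: S_def)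
  have S_mem: "S x \<noteq> {}" if "x \<in> topspace T" for x
  proof -
    have "openin euclidean {a \<in> topspace euclidean. scale a x \<in> W}"
      by (rule openin_continuous_map_preimage[OF continuous_map_orbit[OF that] W(1)])
    then have "open {a. scale a x \<in> W}" by (simp flip: open_openin)
    then obtain d where d: "d > 0" "ball 0 d \<subseteq> {a. scale a x \<in> W}"
      using W(2) by (metis (mono_tags, lifting) mem_Collect_eq open_contains_ball scale_zero_left)
    have "r (inverse (2 / d)) \<in> ball 0 d" using d(1) by (simp add: r_def norm_divide)
    then have "2 / d \<in> S x" using W(3) d by (auto simp: S_def)
    then show ?thesis by blast
  qed
  have S_less: "\<exists>t\<in>S x. t < u" if "x \<in> topspace T" "p x < u" for x u
    using cInf_lessD[OF S_mem[OF that(1)], of u] that(2) by (auto simp: p_def)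
  have p_le: "p x \<le> t" if "t \<in> S x" for x t
    using cInf_lower[OF that bdd] by (simp add: p_def)
  have p_nonneg: "0 \<le> p x" if "x \<in> topspace T" for x
    unfolding p_def by (rule cInf_greatest[OF S_mem[OF that]]) (auto simp: S_def)
  have p_add: "p (x + y) \<le> p x + p y" if x: "x \<in> topspace T" and y: "y \<in> topspace T" for x y
  proof (rule field_le_epsilon)
    fix e :: real assume e: "e > 0"
    obtain t u where t: "t \<in> S x" "t < p x + e / 2" and u: "u \<in> S y" "u < p y + e / 2"
      using S_less[OF x, of "p x + e / 2"] S_less[OF y, of "p y + e / 2"] e by auto
    have pos: "t > 0" "u > 0" using t u by (auto simp: S_def)
    have "scale (r (t / (t + u))) (scale (r (inverse t)) x) + scale (r (u / (t + u))) (scale (r (inverse u)) y) \<in> V"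
    proof (rule conv)
      show "scale (r (inverse t)) x \<in> V" "scale (r (inverse u)) y \<in> V" using t u by (auto simp: S_def)
      have "norm (r (t / (t + u))) + norm (r (u / (t + u))) = t / (t + u) + u / (t + u)"
        using pos by (simp add: r_def norm_divide del: of_real_add of_real_divide)
      also have "\<dots> = 1" using pos by (simp flip: add_divide_distrib)
      finally show "norm (r (t / (t + u))) + norm (r (u / (t + u))) \<le> 1" by simp
    qed
    moreover have "r (t / (t + u)) * r (inverse t) = r (inverse (t + u))"
      "r (u / (t + u)) * r (inverse u) = r (inverse (t + u))"
      using pos by (auto simp: r_def field_simps simp flip: of_real_mult)
    ultimately have "t + u \<in> S (x + y)" using pos by (simp add: S_def scale_right_distrib)
    then show "p (x + y) \<le> p x + p y + e" using p_le t u by fastforce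
  qed
  have p0: "p 0 = 0"
  proof (rule antisym)
    show "p 0 \<le> 0"
    proof (rule field_le_epsilon)
      fix e :: real assume "e > 0"
      then show "p 0 \<le> 0 + e" using W by (intro p_le) (auto simp: S_def)
    qed
  qed (simp add: p_nonneg)
  have p_scale_le: "p (scale a x) \<le> norm a * p x" if x: "x \<in> topspace T" and a: "a \<noteq> 0" for a x
  proof (rule field_le_epsilon)
    fix e :: real assume e: "e > 0"
    have na: "norm a > 0" using a by simp
    obtain t where t: "t \<in> S x" "t < p x + e / norm a"
      using S_less[OF x, of "p x + e / norm a"] e na by auto
    have pos: "t > 0" using t by (simp add: S_def)
    have "scale (a * r (inverse (norm a))) (scale (r (inverse t)) x) \<in> V"
      by (rule bal) (use t a in \<open>auto simp: S_def r_def norm_mult norm_inverse\<close>)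
    then have "norm a * t \<in> S (scale a x)"
      using pos na by (simp add: S_def r_def ac_simps)
    then have "p (scale a x) \<le> norm a * t" by (rule p_le)
    also have "\<dots> \<le> norm a * (p x + e / norm a)" using t na by simp
    also have "\<dots> = norm a * p x + e" using na by (simp add: field_simps)
    finally show "p (scale a x) \<le> norm a * p x + e" .
  qed
  have p_scale: "p (scale a x) = norm a * p x" if x: "x \<in> topspace T" for a x
  proof (cases "a = 0")
    case False
    have "p (scale (inverse a) (scale a x)) \<le> norm (inverse a) * p (scale a x)"
      using False x scale_in by (intro p_scale_le) auto
    then have "p x \<le> p (scale a x) / norm a" using False by (simp add: norm_inverse divide_inverse mult.commute)
    then have "norm a * p x \<le> p (scale a x)" using False by (simp add: pos_le_divide_eq mult.commute)
    then show ?thesis using p_scale_le[OF x False] by simp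
  qed (simp add: p0)
  have "continuous_map T euclideanreal p"
    unfolding continuous_map_def
  proof (intro conjI allI impI)
    fix U :: "real set" assume "openin euclideanreal U"
    then have U: "open U" by (rule open_openin[THEN iffD2])
    show "openin T {x \<in> topspace T. p x \<in> U}"
    proof (subst openin_subopen, intro ballI)
      fix x assume "x \<in> {x \<in> topspace T. p x \<in> U}"
      then have x: "x \<in> topspace T" "p x \<in> U" by auto
      obtain e where e: "e > 0" "\<forall>z. dist z (p x) < e \<longrightarrow> z \<in> U"
        using U x(2) unfolding open_dist by blast
      \<comment> \<open>The neighbourhood \<open>x + (e / 2) W\<close>, written as a preimage of \<open>W\<close>.\<close>
      let ?g = "scale (r (2 / e)) \<circ> (\<lambda>y. y + (- x))"
      let ?N = "{y \<in> topspace T. ?g y \<in> W}"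
      have "continuous_map T T ?g"
        using continuous_map_compose[OF continuous_map_translation continuous_map_dilation] minus_in[OF x(1)] by blast
      then have "openin T ?N" by (rule openin_continuous_map_preimage) (rule W)
      moreover have "x \<in> ?N" using x W by simp
      moreover have "?N \<subseteq> {x \<in> topspace T. p x \<in> U}"
      proof
        fix y assume "y \<in> ?N"
        then have y: "y \<in> topspace T" "?g y \<in> W" by auto
        then have "e / 2 \<in> S (y - x)" using W e by (auto simp: S_def)
        then have d: "p (y - x) < e" using p_le e by fastforce
        have "p (x - y) = p (y - x)" using p_scale[of "y - x" "-1"] diff_in x y by simp
        then have "\<bar>p y - p x\<bar> < e"
          using d p_add[of "y - x" x] p_add[of "x - y" y] diff_in x y by simp
        then show "y \<in> {x \<in> topspace T. p x \<in> U}" using e y by (simp add: dist_real_def)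
      qed
      ultimately show "\<exists>N. openin T N \<and> x \<in> N \<and> N \<subseteq> {x \<in> topspace T. p x \<in> U}" by blast
    qed
  qed auto
  then have "cseminorm p" using p_nonneg p_add p_scale by (simp add: continuous_seminorm_def)
  moreover have "{x \<in> topspace T. p x < 1} \<subseteq> V"
  proof clarify
    fix x assume x: "x \<in> topspace T" "p x < 1"
    obtain t where t: "t \<in> S x" "t < 1" using S_less x by blast
    have "scale (r t) (scale (r (inverse t)) x) \<in> V"
      by (rule bal) (use t in \<open>auto simp: S_def r_def\<close>)
    then show "x \<in> V" using t by (simp add: S_def r_def flip: of_real_mult)
  qed
  ultimately show thesis by (rule that)
qed

lemma zero_nbhd_iff:
  "zero_nbhd T U \<longleftrightarrow> U \<subseteq> topspace T \<and> (\<exists>p. cseminorm p \<and> {x \<in> topspace T. p x < 1} \<subseteq> U)"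
proof
  assume U: "zero_nbhd T U"
  obtain V where V: "V \<subseteq> U" "zero_nbhd T V" "absolutely_convex scale V"
    using locally_convex[OF U] by blast
  obtain p where "cseminorm p" "{x \<in> topspace T. p x < 1} \<subseteq> V"
    using gauge_seminorm[OF V(2,3)] .
  then show "U \<subseteq> topspace T \<and> (\<exists>p. cseminorm p \<and> {x \<in> topspace T. p x < 1} \<subseteq> U)"
    using V(1) U unfolding zero_nbhd_def by blast
next
  assume "U \<subseteq> topspace T \<and> (\<exists>p. cseminorm p \<and> {x \<in> topspace T. p x < 1} \<subseteq> U)"
  then obtain p where "U \<subseteq> topspace T" "cseminorm p" "{x \<in> topspace T. p x < 1} \<subseteq> U"
    by blast
  then show "zero_nbhd T U"
    using zero_nbhd_seminorm_ball[of p 1] unfolding zero_nbhd_def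
    by (metis (no_types, lifting) order_trans zero_less_one)
qed

lemma openin_iff_seminorm:
  "openin T U \<longleftrightarrow> U \<subseteq> topspace T \<and>
     (\<forall>x\<in>U. \<exists>p. cseminorm p \<and> (\<forall>y\<in>topspace T. p (y - x) < 1 \<longrightarrow> y \<in> U))"
proof (intro iffI conjI ballI; (elim conjE)?)
  assume U: "openin T U"
  then show "U \<subseteq> topspace T" by (rule openin_subset)
  fix x assume x: "x \<in> U"
  then have xT: "x \<in> topspace T" using U openin_subset by blast
  have "zero_nbhd T {y \<in> topspace T. y + x \<in> U}"
    using openin_continuous_map_preimage[OF continuous_map_translation[OF xT] U] x
    unfolding zero_nbhd_def by (intro conjI exI[of _ "{y \<in> topspace T. y + x \<in> U}"]) auto
  then obtain p where p: "cseminorm p" "{y \<in> topspace T. p y < 1} \<subseteq> {y \<in> topspace T. y + x \<in> U}"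
    unfolding zero_nbhd_iff by blast
  then have "\<forall>y\<in>topspace T. p (y - x) < 1 \<longrightarrow> y \<in> U" using diff_in[OF _ xT] by force
  then show "\<exists>p. cseminorm p \<and> (\<forall>y\<in>topspace T. p (y - x) < 1 \<longrightarrow> y \<in> U)" using p by blast
next
  assume U: "U \<subseteq> topspace T" and *: "\<forall>x\<in>U. \<exists>p. cseminorm p \<and> (\<forall>y\<in>topspace T. p (y - x) < 1 \<longrightarrow> y \<in> U)"
  show "openin T U"
  proof (subst openin_subopen, intro ballI)
    fix x assume x: "x \<in> U"
    then obtain p where p: "cseminorm p" "\<forall>y\<in>topspace T. p (y - x) < 1 \<longrightarrow> y \<in> U" using * by blast
    have "x \<in> topspace T" using x U by blast
    then show "\<exists>N. openin T N \<and> x \<in> N \<and> N \<subseteq> U"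
      using p openin_seminorm_ball[OF p(1), of x 1]
      by (intro exI[of _ "{y \<in> topspace T. p (y - x) < 1}"]) (auto simp: cseminorm_zero)
  qed
qed

text \<open>
  A Lebesgue number argument: the sum of the finitely many seminorms of a subcover, doubled, works
  for every point of \<open>L\<close> at once.
\<close>

lemma compact_uniform_nbhd:
  assumes L: "compactin T L" and U: "openin T U" and LU: "L \<subseteq> U"
  obtains p where "cseminorm p" "\<And>x y. x \<in> L \<Longrightarrow> y \<in> topspace T \<Longrightarrow> p (y - x) < 1 \<Longrightarrow> y \<in> U"
proof -
  have LT: "L \<subseteq> topspace T" using L compactin_subset_topspace by blast
  have "\<forall>x\<in>L. \<exists>p. cseminorm p \<and> (\<forall>y\<in>topspace T. p (y - x) < 1 \<longrightarrow> y \<in> U)"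
    using U LU unfolding openin_iff_seminorm by blast
  then obtain p where p: "\<And>x. x \<in> L \<Longrightarrow> cseminorm (p x)"
    "\<And>x y. x \<in> L \<Longrightarrow> y \<in> topspace T \<Longrightarrow> p x (y - x) < 1 \<Longrightarrow> y \<in> U" by metis
  let ?B = "\<lambda>x. {y \<in> topspace T. p x (y - x) < 1 / 2}"
  have "openin T (?B x)" "x \<in> ?B x" if "x \<in> L" for x
    using openin_seminorm_ball[OF p(1)[OF that], of x "1 / 2"] that LT p(1)[OF that]
    by (auto simp: cseminorm_zero)
  then have "\<exists>\<F>. finite \<F> \<and> \<F> \<subseteq> ?B ` L \<and> L \<subseteq> \<Union>\<F>"
    by (intro compactinD[OF L]) blast+
  then obtain I where I: "finite I" "I \<subseteq> L" "L \<subseteq> \<Union>(?B ` I)"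
    by (metis (no_types, lifting) finite_subset_image)
  let ?q = "\<lambda>x. 2 * (\<Sum>i\<in>I. p i x)"
  have "cseminorm ?q" using I p by (intro cseminorm_scaleR cseminorm_sum) auto
  moreover have "y \<in> U" if x: "x \<in> L" and y: "y \<in> topspace T" and q: "?q (y - x) < 1" for x y
  proof -
    obtain i where i: "i \<in> I" "p i (x - i) < 1 / 2" using I x by blast
    have T: "x \<in> topspace T" "i \<in> topspace T" using x i I LT by auto
    have "p i (y - x) \<le> (\<Sum>i\<in>I. p i (y - x))"
      using I i p diff_in[OF y T(1)] by (intro member_le_sum) (auto intro!: cseminorm_nonneg)
    then have "p i (y - i) < 1"
      using q i cseminorm_triangle[of "p i" y x i] p I y T by (fastforce simp: subset_iff)
    then show ?thesis using p(2) i I y by blast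
  qed
  ultimately show thesis by (rule that)
qed

lemma tvs_bounded_iff:
  "tvs_bounded scale T B \<longleftrightarrow> B \<subseteq> topspace T \<and> (\<forall>p. cseminorm p \<longrightarrow> (\<exists>M. \<forall>x\<in>B. p x \<le> M))"
proof (intro iffI conjI allI impI; (elim conjE)?)
  assume B: "tvs_bounded scale T B"
  then show "B \<subseteq> topspace T" by (simp add: tvs_bounded_def)
  fix p assume p: "cseminorm p"
  then have "absorbs scale {x \<in> topspace T. p x < 1} B"
    using B zero_nbhd_seminorm_ball[OF p, of 1] by (auto simp: tvs_bounded_def)
  then obtain r where r: "r > 0" "B \<subseteq> scale (of_real r) ` {x \<in> topspace T. p x < 1}"
    unfolding absorbs_def by (metis abs_of_pos norm_of_real order_refl)
  then have "\<forall>x\<in>B. p x \<le> r" using p by (fastforce simp: cseminorm_scale)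
  then show "\<exists>M. \<forall>x\<in>B. p x \<le> M" by blast
next
  assume B: "B \<subseteq> topspace T" "\<forall>p. cseminorm p \<longrightarrow> (\<exists>M. \<forall>x\<in>B. p x \<le> M)"
  have "absorbs scale U B" if "zero_nbhd T U" for U
  proof -
    obtain p where p: "cseminorm p" "{x \<in> topspace T. p x < 1} \<subseteq> U" using \<open>zero_nbhd T U\<close> zero_nbhd_iff by auto
    obtain M where M: "\<forall>x\<in>B. p x \<le> M" using B p by blast
    show ?thesis unfolding absorbs_def
    proof (intro exI[of _ "\<bar>M\<bar> + 1"] conjI allI impI subsetI)
      fix a :: 'k and x assume a: "\<bar>M\<bar> + 1 \<le> norm a" and x: "x \<in> B"
      have a0: "a \<noteq> 0" using a by auto
      have "p x < norm a" using M x a by fastforce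
      have "p (scale (inverse a) x) = p x / norm a"
        using x B(1) cseminorm_scale[OF p(1), of x "inverse a"]
        by (auto simp: norm_inverse divide_inverse mult.commute)
      then have "p (scale (inverse a) x) < 1" using \<open>p x < norm a\<close> a0 by (simp add: divide_less_eq)
      then have "scale (inverse a) x \<in> U" using p x B scale_in by blast
      moreover have "x = scale a (scale (inverse a) x)" using a0 by simp
      ultimately show "x \<in> scale a ` U" by blast
    qed simp
  qed
  then show "tvs_bounded scale T B" using B by (simp add: tvs_bounded_def)
qed

lemma compactin_imp_tvs_bounded:
  assumes C: "compactin T C" shows "tvs_bounded scale T C"
  unfolding tvs_bounded_iff
proof (intro conjI allI impI)
  show "C \<subseteq> topspace T" using C compactin_subset_topspace by blast
  fix p assume "cseminorm p"
  then have "compact (p ` C)"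
    using image_compactin[OF C cseminorm_continuous] by simp
  then show "\<exists>M. \<forall>x\<in>C. p x \<le> M"
    using compact_imp_bounded bounded_real by (metis abs_le_D1 imageI)
qed

lemma compactin_set_add:
  assumes "compactin T A" "compactin T B"
  shows "compactin T ((\<lambda>(x, y). x + y) ` (A \<times> B))"
  using image_compactin[OF _ continuous_add] assms by (simp add: compactin_Times)

end


section \<open>Bounded sets in complete nuclear spaces\<close>

text \<open>
  Zorn's lemma for the proper filters finer than \<open>F0\<close>: the infimum of a chain of proper filters is
  proper, because an event that is eventual for the infimum is eventual for a member of the chain.
\<close>

lemma exists_ultrafilter:
  assumes "F0 \<noteq> bot"
  obtains F where "F \<le> F0" "F \<noteq> bot" "\<And>P. eventually P F \<or> eventually (\<lambda>x. \<not> P x) F"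
proof -
  define A where "A = {F. F \<le> F0 \<and> F \<noteq> bot}"
  have A: "F \<in> A \<longleftrightarrow> F \<le> F0 \<and> \<not> eventually (\<lambda>_. False) F" for F
    by (simp add: A_def trivial_limit_def)
  have po: "partial_order_on A (relation_of (\<ge>) A)"
    by (rule partial_order_on_relation_ofI) (blast intro: order_refl order_trans order_antisym)+
  have "\<exists>U\<in>A. \<forall>F\<in>C. U \<le> F" if chain: "C \<in> Chains (relation_of (\<ge>) A)" for C
  proof (cases "C = {}")
    case False
    have C: "F \<in> A" "G \<le> F \<or> F \<le> G" if "F \<in> C" "G \<in> C" for F G
      using that chain unfolding Chains_def relation_of_def by blast+
    have "\<exists>H\<in>C. H \<le> inf F G" if "F \<in> C" "G \<in> C" for F G
      using C(2)[OF that] that by (metis inf.absorb1 inf.absorb2 order_refl)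
    then have "eventually (\<lambda>_. False) (Inf C) \<longleftrightarrow> (\<exists>F\<in>C. eventually (\<lambda>_. False) F)"
      by (rule eventually_Inf_base[OF False])
    then have "\<not> eventually (\<lambda>_. False) (Inf C)" using C(1) A by blast
    moreover obtain F where "F \<in> C" using False by blast
    then have "Inf C \<le> F0" using Inf_lower2 C(1) A by metis
    ultimately have "Inf C \<in> A" using A by blast
    then show ?thesis by (meson Inf_lower)
  next
    case True
    then show ?thesis using assms unfolding A_def by blast
  qed
  then have "\<exists>F\<in>A. \<forall>G\<in>A. G \<le> F \<longrightarrow> G = F"
    by (rule predicate_Zorn[OF po])
  then obtain F where F: "F \<in> A" and max: "\<forall>G\<in>A. G \<le> F \<longrightarrow> G = F"
    by (rule bexE)
  have "eventually P F \<or> eventually (\<lambda>x. \<not> P x) F" for P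
  proof (rule disjCI)
    assume "\<not> eventually (\<lambda>x. \<not> P x) F"
    then have "\<not> eventually (\<lambda>_. False) (inf F (principal {x. P x}))"
      by (simp add: eventually_inf_principal)
    then have "inf F (principal {x. P x}) \<in> A"
      using F order_trans[OF inf_le1, of F F0] unfolding A by simp
    then have eq: "inf F (principal {x. P x}) = F" using max inf_le1 by simp
    have "eventually P (inf F (principal {x. P x}))"
      by (simp add: eventually_inf_principal)
    then show "eventually P F" unfolding eq .
  qed
  then show thesis using that F unfolding A_def by blast
qed

lemma sum_fun_apply: "(\<Sum>k\<in>I. f k) j = (\<Sum>k\<in>I. f k j)"
  for f :: "'i \<Rightarrow> 'j \<Rightarrow> 'a::comm_monoid_add"
  by (induction I rule: infinite_finite_induct) auto

lemma finite_scalar_net: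
  assumes "e > 0"
  obtains S :: "'k::real_normed_field set" where "finite S" "\<And>x. norm x \<le> M \<Longrightarrow> \<exists>s\<in>S. dist s x < e"
proof -
  obtain C :: "'k set" where C: "compact C" "cball 0 M \<subseteq> C" using bounded_scalars_in_compact .
  have "\<forall>e>0. \<exists>S. finite S \<and> C \<subseteq> (\<Union>x\<in>S. ball x e)"
    using C(1) unfolding compact_eq_totally_bounded by (rule conjunct2)
  then obtain S where S: "finite S" "C \<subseteq> (\<Union>x\<in>S. ball x e)"
    using assms by blast
  have "\<exists>s\<in>S. dist s x < e" if "norm x \<le> M" for x
  proof -
    have "x \<in> C" using that C(2) by auto
    then obtain s where "s \<in> S" "x \<in> ball s e" using S(2) by blast
    then show ?thesis by auto
  qed
  with S(1) show thesis by (rule that)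
qed

context locally_convex_space
begin

lemma completion_const: "x \<in> topspace T \<Longrightarrow> cseminorm p \<Longrightarrow> (\<lambda>_. x) \<in> completion (topspace T) p"
  by (simp add: completion_def cseminorm_zero)

lemma completion_add:
  assumes p: "cseminorm p" and z: "z \<in> completion (topspace T) p" and w: "w \<in> completion (topspace T) p"
  shows "z + w \<in> completion (topspace T) p"
  unfolding completion_def
proof (intro CollectI conjI allI impI)
  have T: "z j \<in> topspace T" "w j \<in> topspace T" for j using z w by (auto simp: completion_def)
  show "(z + w) j \<in> topspace T" for j using T by (simp add: add_in)
  fix e :: real assume "e > 0"
  then have e2: "e / 2 > 0" by simp
  obtain M where M: "\<And>i j. i \<ge> M \<Longrightarrow> j \<ge> M \<Longrightarrow> p (z i - z j) < e / 2"
    using z e2 unfolding completion_def by blast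
  obtain N where N: "\<And>i j. i \<ge> N \<Longrightarrow> j \<ge> N \<Longrightarrow> p (w i - w j) < e / 2"
    using w e2 unfolding completion_def by blast
  have "p ((z + w) i - (z + w) j) < e" if "i \<ge> max M N" "j \<ge> max M N" for i j
  proof -
    have "(z + w) i - (z + w) j = (z i - z j) + (w i - w j)" by simp
    then have "p ((z + w) i - (z + w) j) \<le> p (z i - z j) + p (w i - w j)"
      by (simp only: cseminorm_add[OF p diff_in[OF T(1) T(1)] diff_in[OF T(2) T(2)]])
    then show ?thesis using M[of i j] N[of i j] that by simp
  qed
  then show "\<exists>N. \<forall>i\<ge>N. \<forall>j\<ge>N. p ((z + w) i - (z + w) j) < e" by blast
qed

lemma completion_scale:
  assumes p: "cseminorm p" and z: "z \<in> completion (topspace T) p"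
  shows "pointwise_scale scale a z \<in> completion (topspace T) p"
  unfolding completion_def
proof (intro CollectI conjI allI impI)
  have T: "z j \<in> topspace T" for j using z by (auto simp: completion_def)
  show "pointwise_scale scale a z j \<in> topspace T" for j using T by (simp add: scale_in pointwise_scale_def)
  fix e :: real assume e: "e > 0"
  have pos: "norm a + 1 > 0" by (simp add: add_nonneg_pos)
  then have "e / (norm a + 1) > 0" using e by simp
  then obtain M where M: "\<And>i j. i \<ge> M \<Longrightarrow> j \<ge> M \<Longrightarrow> p (z i - z j) < e / (norm a + 1)"
    using z unfolding completion_def by blast
  have "p (pointwise_scale scale a z i - pointwise_scale scale a z j) < e" if "i \<ge> M" "j \<ge> M" for i j
  proof -
    have d: "z i - z j \<in> topspace T" using T diff_in by blast
    have "p (pointwise_scale scale a z i - pointwise_scale scale a z j) = norm a * p (z i - z j)"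
      using cseminorm_scale[OF p d, of a] by (simp add: pointwise_scale_def scale_right_diff_distrib)
    also have "\<dots> \<le> (norm a + 1) * p (z i - z j)" using cseminorm_nonneg[OF p d] by (simp add: distrib_right)
    also have "\<dots> < e" using M[OF that] pos by (simp add: pos_less_divide_eq mult.commute)
    finally show ?thesis .
  qed
  then show "\<exists>N. \<forall>i\<ge>N. \<forall>j\<ge>N. p (pointwise_scale scale a z i - pointwise_scale scale a z j) < e" by blast
qed

lemma completion_seminorm_limit:
  assumes p: "cseminorm p" and z: "z \<in> completion (topspace T) p"
  shows "(\<lambda>j. p (z j)) \<longlonglongrightarrow> completion_seminorm p z"
proof -
  have T: "z j \<in> topspace T" for j using z by (auto simp: completion_def)
  have "Cauchy (\<lambda>j. p (z j))"
  proof (rule CauchyI)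
    fix e :: real assume "e > 0"
    then obtain N where N: "\<And>i j. i \<ge> N \<Longrightarrow> j \<ge> N \<Longrightarrow> p (z i - z j) < e"
      using z unfolding completion_def by blast
    have "p (z i) - p (z j) < e" if "i \<ge> N" "j \<ge> N" for i j
      using cseminorm_add[OF p diff_in[OF T T] T, of i j j] N[OF that] by simp
    then have "norm (p (z i) - p (z j)) < e" if "i \<ge> N" "j \<ge> N" for i j
      using that by (simp add: abs_less_iff)
    then show "\<exists>N. \<forall>i\<ge>N. \<forall>j\<ge>N. norm (p (z i) - p (z j)) < e" by blast
  qed
  then show ?thesis
    by (simp add: completion_seminorm_def Cauchy_convergent_iff convergent_LIMSEQ_iff)
qed

text \<open>
  Nuclearity says that the map \<open>\<Sum> c k f k (x) y k\<close> represents the identity, so the identity is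
  approximated by finite rank operators in a uniform way: up to an error \<open>e q x\<close>, coming from the tail
  of the summable sequence \<open>c\<close>, the seminorm \<open>p\<close> is controlled by finitely many linear functionals
  \<open>g k = c k f k\<close>.  The points of the space enter as constant sequences in the completion.
\<close>

lemma nuclear_seminorm_bound:
  assumes nuc: "nuclear_space scale T" and p: "cseminorm p"
  obtains q C where "cseminorm q"
    "\<And>e. e > 0 \<Longrightarrow> \<exists>(N::nat) g. (\<forall>k<N. linear_on scale (*) (topspace T) (g k) \<and>
        (\<forall>x\<in>topspace T. norm (g k x) \<le> C * q x)) \<and>
        (\<forall>x\<in>topspace T. p x \<le> (\<Sum>k<N. norm (g k x)) + e * q x)"
proof -
  let ?E = "topspace T" and ?s = "pointwise_scale scale"
  obtain q where q: "cseminorm q" and "nuclear_operator ?s (completion ?E q) (completion_seminorm q)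
      ?s (completion ?E p) (completion_seminorm p) (\<lambda>z. z)"
    using nuc p unfolding nuclear_space_def by blast
  then obtain c f y where c: "summable (\<lambda>k. norm (c k))"
    and f: "\<And>k. linear_on ?s (*) (completion ?E q) (f k)"
      "\<And>k z. z \<in> completion ?E q \<Longrightarrow> norm (f k z) \<le> completion_seminorm q z"
    and y: "\<And>k. y k \<in> completion ?E p" "\<And>k. completion_seminorm p (y k) \<le> 1"
    and lim: "\<And>z. z \<in> completion ?E q \<Longrightarrow>
      (\<lambda>N. completion_seminorm p (z - (\<Sum>k<N. ?s (c k * f k z) (y k)))) \<longlonglongrightarrow> 0"
    unfolding nuclear_operator_def by blast
  define g where "g k x = c k * f k (\<lambda>_. x)" for k x
  define C where "C = (\<Sum>k. norm (c k))"
  have cC: "norm (c k) \<le> C" for k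
    using sum_le_suminf[OF c, of "{k}"] by (simp add: C_def)
  have f_le: "norm (f k (\<lambda>_. x)) \<le> q x" if "x \<in> ?E" for k x
    using f(2)[OF completion_const[OF that q], of k] by (simp add: completion_seminorm_def)
  have g_le: "norm (g k x) \<le> norm (c k) * q x" if "x \<in> ?E" for k x
    unfolding g_def norm_mult using f_le[OF that] by (rule mult_left_mono) simp
  have lin: "linear_on scale (*) ?E (g k)" for k
    unfolding linear_on_def
  proof (intro conjI ballI allI)
    fix x w assume xw: "x \<in> ?E" "w \<in> ?E"
    have "f k ((\<lambda>_. x) + (\<lambda>_. w)) = f k (\<lambda>_. x) + f k (\<lambda>_. w)"
      using f(1)[of k] completion_const[OF _ q] xw unfolding linear_on_def by blast
    moreover have "(\<lambda>_. x) + (\<lambda>_. w) = (\<lambda>_::nat. x + w)" by (simp add: plus_fun_def)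
    ultimately show "g k (x + w) = g k x + g k w" by (simp add: g_def distrib_left)
  next
    fix a x assume x: "x \<in> ?E"
    have "f k (?s a (\<lambda>_. x)) = a * f k (\<lambda>_. x)"
      using f(1)[of k] completion_const[OF x q] unfolding linear_on_def by blast
    then show "g k (scale a x) = a * g k x" by (simp add: g_def pointwise_scale_def)
  qed
  have partial: "p x \<le> completion_seminorm p ((\<lambda>_. x) - (\<Sum>k<n. ?s (c k * f k (\<lambda>_. x)) (y k))) + (\<Sum>k<n. norm (g k x))"
    (is "_ \<le> completion_seminorm p ?r + _") if x: "x \<in> ?E" for x n
  proof -
    define S where "S = (\<Sum>k<n. ?s (g k x) (y k))"
    have S_mem: "(\<Sum>k<n. ?s (g k x) (y k)) \<in> completion ?E p" for n
    proof (induction n)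
      case 0
      then show ?case using completion_const[OF zero_in p] by (simp add: zero_fun_def)
    next
      case (Suc n)
      show ?case
        unfolding sum.lessThan_Suc by (rule completion_add[OF p Suc completion_scale[OF p y(1)]])
    qed
    \<comment> \<open>The difference with \<open>S\<close> is rewritten as a sum, as closure of the completion is available for sums.\<close>
    have "?s (-1) S \<in> completion ?E p" using completion_scale[OF p S_mem] unfolding S_def .
    then have "(\<lambda>_. x) + ?s (-1) S \<in> completion ?E p"
      using completion_add[OF p completion_const[OF x p]] by blast
    moreover have req: "(\<lambda>_. x) + ?s (-1) S = ?r"
      by (rule ext) (simp add: S_def g_def pointwise_scale_def)
    ultimately have r: "?r \<in> completion ?E p" by simp
    have SE: "S j \<in> ?E" and yE: "y k j \<in> ?E" and rE: "?r j \<in> ?E" for k j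
      using S_mem[of n] y(1) r unfolding S_def completion_def by blast+
    have "p x \<le> p (?r j) + (\<Sum>k<n. norm (g k x) * p (y k j))" for j
    proof -
      have sum_le: "(\<Sum>k<m. scale (g k x) (y k j)) \<in> ?E \<and>
          p (\<Sum>k<m. scale (g k x) (y k j)) \<le> (\<Sum>k<m. norm (g k x) * p (y k j))" for m
      proof (induction m)
        case (Suc m)
        then show ?case
          using cseminorm_add[OF p, of "\<Sum>k<m. scale (g k x) (y k j)" "scale (g m x) (y m j)"]
            cseminorm_scale[OF p yE[of m j], of "g m x"] scale_in[OF yE[of m j]] add_in by auto
      qed (simp add: cseminorm_zero[OF p])
      have Sj: "S j = (\<Sum>k<n. scale (g k x) (y k j))" by (simp add: S_def sum_fun_apply pointwise_scale_def)
      have "?r j = x - S j" by (simp add: S_def g_def)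
      then have "p x \<le> p (?r j) + p (S j)" using cseminorm_add[OF p rE SE, of j j] by simp
      also have "p (S j) \<le> (\<Sum>k<n. norm (g k x) * p (y k j))" using sum_le Sj by simp
      finally show ?thesis by simp
    qed
    moreover have "(\<lambda>j. p (?r j) + (\<Sum>k<n. norm (g k x) * p (y k j))) \<longlonglongrightarrow>
        completion_seminorm p ?r + (\<Sum>k<n. norm (g k x) * completion_seminorm p (y k))"
      by (intro tendsto_intros completion_seminorm_limit p r y)
    ultimately have "p x \<le> completion_seminorm p ?r + (\<Sum>k<n. norm (g k x) * completion_seminorm p (y k))"
      by (intro LIMSEQ_le_const) auto
    moreover have "(\<Sum>k<n. norm (g k x) * completion_seminorm p (y k)) \<le> (\<Sum>k<n. norm (g k x))"
      using y(2) by (intro sum_mono mult_left_le) auto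
    ultimately show ?thesis by linarith
  qed
  have "\<exists>(N::nat) g. (\<forall>k<N. linear_on scale (*) ?E (g k) \<and> (\<forall>x\<in>?E. norm (g k x) \<le> C * q x)) \<and>
        (\<forall>x\<in>?E. p x \<le> (\<Sum>k<N. norm (g k x)) + e * q x)" if e: "e > 0" for e
  proof -
    obtain N where N: "\<And>m n. m \<ge> N \<Longrightarrow> norm (\<Sum>k=m..<n. norm (c k)) < e"
      using c e unfolding summable_Cauchy by blast
    have "p x \<le> (\<Sum>k<N. norm (g k x)) + e * q x" if x: "x \<in> ?E" for x
    proof -
      let ?r = "\<lambda>n. completion_seminorm p ((\<lambda>_. x) - (\<Sum>k<n. ?s (c k * f k (\<lambda>_. x)) (y k)))"
      have q0: "0 \<le> q x" using cseminorm_nonneg[OF q x] .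
      have "p x \<le> ?r n + ((\<Sum>k<N. norm (g k x)) + e * q x)" if n: "n \<ge> N" for n
      proof -
        have "(\<Sum>k<n. norm (g k x)) = (\<Sum>k<N. norm (g k x)) + (\<Sum>k=N..<n. norm (g k x))"
          using n by (simp add: lessThan_atLeast0 sum.atLeastLessThan_concat)
        moreover have "(\<Sum>k=N..<n. norm (g k x)) \<le> (\<Sum>k=N..<n. norm (c k)) * q x"
          unfolding sum_distrib_right using g_le[OF x] by (rule sum_mono)
        moreover have "(\<Sum>k=N..<n. norm (c k)) * q x \<le> e * q x"
          using N[of N n] q0 by (intro mult_right_mono) auto
        ultimately show ?thesis using partial[OF x, of n] by linarith
      qed
      moreover have "(\<lambda>n. ?r n + ((\<Sum>k<N. norm (g k x)) + e * q x)) \<longlonglongrightarrow> 0 + ((\<Sum>k<N. norm (g k x)) + e * q x)"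
        by (intro tendsto_add tendsto_const lim completion_const x q)
      ultimately have "p x \<le> 0 + ((\<Sum>k<N. norm (g k x)) + e * q x)"
        by (intro LIMSEQ_le_const) auto
      then show ?thesis by simp
    qed
    moreover have "norm (g k x) \<le> C * q x" if "x \<in> ?E" for k x
      using g_le[OF that] cC cseminorm_nonneg[OF q that] by (meson mult_right_mono order_trans)
    ultimately show ?thesis using lin by blast
  qed
  with q show thesis by (rule that)
qed

text \<open>
  The functionals that control \<open>p\<close> map \<open>B\<close> to a bounded set of finite tuples of scalars, which has a
  finite net since the scalar field is locally compact.  The tuples near one net point form a cell of
  small \<open>p\<close>-diameter.
\<close>

lemma nuclear_bounded_imp_precompact:
  assumes nuc: "nuclear_space scale T" and B: "tvs_bounded scale T B" and p: "cseminorm p" and e: "e > 0"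
  obtains \<C> where "finite \<C>" "B \<subseteq> \<Union>\<C>" "\<And>D x y. D \<in> \<C> \<Longrightarrow> x \<in> D \<Longrightarrow> y \<in> D \<Longrightarrow> p (x - y) < e"
proof -
  let ?E = "topspace T"
  obtain q C where q: "cseminorm q" and qC:
    "\<And>e. e > 0 \<Longrightarrow> \<exists>(N::nat) g. (\<forall>k<N. linear_on scale (*) ?E (g k) \<and>
        (\<forall>x\<in>?E. norm (g k x) \<le> C * q x)) \<and> (\<forall>x\<in>?E. p x \<le> (\<Sum>k<N. norm (g k x)) + e * q x)"
    using nuclear_seminorm_bound[OF nuc p] by blast
  obtain M0 where M0: "\<And>x. x \<in> B \<Longrightarrow> q x \<le> M0" and BE: "B \<subseteq> ?E"
    using B q unfolding tvs_bounded_iff by blast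
  define M where "M = \<bar>M0\<bar> + 1"
  have M: "M > 0" "\<And>x. x \<in> B \<Longrightarrow> q x \<le> M" using M0 by (fastforce simp: M_def)+
  have "e / (4 * M) > 0" using e M by simp
  from qC[OF this] obtain N :: nat and g where
    g': "\<forall>k<N. linear_on scale (*) ?E (g k) \<and> (\<forall>x\<in>?E. norm (g k x) \<le> C * q x)"
    and p_le: "\<forall>x\<in>?E. p x \<le> (\<Sum>k<N. norm (g k x)) + e / (4 * M) * q x"
    by blast
  have g: "linear_on scale (*) ?E (g k)" "x \<in> ?E \<Longrightarrow> norm (g k x) \<le> C * q x" if "k < N" for k x
    using g' that by blast+
  define d where "d = e / (4 * (real N + 1))"
  have d: "d > 0" using e by (simp add: d_def)
  obtain S :: "'k set" where S: "finite S" "\<And>a. norm a \<le> \<bar>C\<bar> * M \<Longrightarrow> \<exists>s\<in>S. dist s a < d"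
    using finite_scalar_net[OF d] by blast
  define cell where "cell s = {x \<in> B. \<forall>k<N. dist (s k) (g k x) < d}" for s
  have "x \<in> \<Union>(cell ` PiE {..<N} (\<lambda>_. S))" if x: "x \<in> B" for x
  proof -
    have "norm (g k x) \<le> \<bar>C\<bar> * M" if "k < N" for k
    proof -
      have "norm (g k x) \<le> C * q x" using g(2) that x BE by blast
      also have "\<dots> \<le> \<bar>C\<bar> * M" using M x BE cseminorm_nonneg[OF q, of x] by (intro mult_mono) auto
      finally show ?thesis .
    qed
    then have "\<forall>k\<in>{..<N}. \<exists>s. s \<in> S \<and> dist s (g k x) < d" using S(2) by blast
    then obtain s where s: "\<forall>k\<in>{..<N}. s k \<in> S \<and> dist (s k) (g k x) < d" by metis
    have "restrict s {..<N} \<in> PiE {..<N} (\<lambda>_. S)" using s by auto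
    moreover have "x \<in> cell (restrict s {..<N})" using s x by (auto simp: cell_def)
    ultimately show ?thesis by blast
  qed
  moreover have "p (x - y) < e" if D: "D \<in> cell ` PiE {..<N} (\<lambda>_. S)" "x \<in> D" "y \<in> D" for D x y
  proof -
    obtain s where s: "x \<in> cell s" "y \<in> cell s" using D by blast
    have E: "x \<in> ?E" "y \<in> ?E" and xyB: "x \<in> B" "y \<in> B" using s BE by (auto simp: cell_def)
    have "norm (g k (x - y)) \<le> 2 * d" if k: "k < N" for k
    proof -
      have "g k (x - y) = g k x - g k y"
      proof -
        have "g k ((x - y) + y) = g k (x - y) + g k y"
          using g(1)[OF k] diff_in[OF E] E unfolding linear_on_def by blast
        then show ?thesis by simp
      qed
      also have "norm \<dots> = dist (g k x) (g k y)" by (simp add: dist_norm)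
      also have "\<dots> \<le> dist (s k) (g k x) + dist (s k) (g k y)" by (rule dist_triangle3)
      also have "\<dots> \<le> 2 * d" using s k by (fastforce simp: cell_def)
      finally show ?thesis .
    qed
    then have "(\<Sum>k<N. norm (g k (x - y))) \<le> real N * (2 * d)"
      using sum_mono[of "{..<N}" "\<lambda>k. norm (g k (x - y))" "\<lambda>_. 2 * d"] by simp
    also have "\<dots> < e / 2" using e by (simp add: d_def field_simps)
    finally have 1: "(\<Sum>k<N. norm (g k (x - y))) < e / 2" .
    have "q (x - y) \<le> 2 * M" using cseminorm_diff[OF q E] M(2)[OF xyB(1)] M(2)[OF xyB(2)] by linarith
    then have "e / (4 * M) * q (x - y) \<le> e / (4 * M) * (2 * M)" using e M by (intro mult_left_mono) auto
    also have "\<dots> = e / 2" using M by simp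
    finally show ?thesis using 1 p_le[rule_format, OF diff_in[OF E]] by simp
  qed
  ultimately show thesis
    using S(1) by (intro that[of "cell ` PiE {..<N} (\<lambda>_. S)"] finite_imageI finite_PiE) auto
qed

text \<open>
  An ultrafilter on a precompact set contains one of the finitely many small sets that cover it, so
  it is Cauchy; its limit lies in every closed set belonging to it.
\<close>

lemma complete_precompact_closed_imp_compactin:
  assumes comp: "tvs_complete T" and B: "closedin T B"
    and pre: "\<And>p. cseminorm p \<Longrightarrow> \<exists>\<C>. finite \<C> \<and> B \<subseteq> \<Union>\<C> \<and> (\<forall>D\<in>\<C>. \<forall>x\<in>D. \<forall>y\<in>D. p (x - y) < 1)"
  shows "compactin T B"
  unfolding compactin_fip
proof (intro conjI allI impI; (elim conjE)?)
  show BE: "B \<subseteq> topspace T" using B closedin_subset by blast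
  fix \<U> assume closed: "\<forall>C\<in>\<U>. closedin T C"
    and fip: "\<forall>\<F>. finite \<F> \<and> \<F> \<subseteq> \<U> \<longrightarrow> B \<inter> \<Inter>\<F> \<noteq> {}"
  define F0 where "F0 = (INF C\<in>insert B \<U>. principal C)"
  have "F0 \<noteq> bot" unfolding F0_def
  proof (rule INF_filter_not_bot)
    fix \<V> assume V: "\<V> \<subseteq> insert B \<U>" "finite \<V>"
    then have "finite (\<V> - {B})" "\<V> - {B} \<subseteq> \<U>" by auto
    then have "B \<inter> \<Inter>(\<V> - {B}) \<noteq> {}" using fip by simp
    moreover have "B \<inter> \<Inter>(\<V> - {B}) \<subseteq> \<Inter>\<V>" by blast
    ultimately have "\<Inter>\<V> \<noteq> {}" by blast
    then show "(INF C\<in>\<V>. principal C) \<noteq> bot"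
      using INF_principal_finite[OF V(2), of "\<lambda>x. x"] by (simp add: principal_eq_bot_iff)
  qed
  then obtain F where F: "F \<le> F0" "F \<noteq> bot" "\<And>P. eventually P F \<or> eventually (\<lambda>x. \<not> P x) F"
    using exists_ultrafilter by blast
  have ev: "eventually (\<lambda>x. x \<in> C) F" if "C \<in> insert B \<U>" for C
  proof -
    have "F \<le> principal C" using F(1) INF_lower[OF that, of principal] unfolding F0_def by (rule order_trans)
    then show ?thesis by (simp add: le_principal)
  qed
  have "\<exists>A. eventually (\<lambda>x. x \<in> A) F \<and> (\<forall>x\<in>A. \<forall>y\<in>A. x - y \<in> U)" if U: "zero_nbhd T U" for U
  proof -
    obtain p where p: "cseminorm p" "{x \<in> topspace T. p x < 1} \<subseteq> U" using U unfolding zero_nbhd_iff by blast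
    obtain \<C> where \<C>: "finite \<C>" "B \<subseteq> \<Union>\<C>" "\<forall>D\<in>\<C>. \<forall>x\<in>D. \<forall>y\<in>D. p (x - y) < 1" using pre[OF p(1)] by blast
    have "\<exists>D\<in>\<C>. eventually (\<lambda>x. x \<in> D) F"
    proof (rule ccontr)
      assume "\<not> ?thesis"
      then have "\<forall>D\<in>\<C>. eventually (\<lambda>x. x \<notin> D) F" using F(3) by blast
      then have "eventually (\<lambda>x. \<forall>D\<in>\<C>. x \<notin> D) F" using \<C>(1) by (simp add: eventually_ball_finite)
      then have "eventually (\<lambda>x. False) F"
        using ev[of B] by (rule eventually_elim2) (use \<C>(2) in auto)
      then show False using F(2) by (simp add: trivial_limit_def)
    qed
    then obtain D where D: "D \<in> \<C>" "eventually (\<lambda>x. x \<in> D) F" by blast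
    have "eventually (\<lambda>x. x \<in> D \<inter> B) F" using D(2) ev[of B] by (simp add: eventually_conj)
    moreover have "\<forall>x\<in>D \<inter> B. \<forall>y\<in>D \<inter> B. x - y \<in> U"
    proof (intro ballI)
      fix x y assume xy: "x \<in> D \<inter> B" "y \<in> D \<inter> B"
      then have "x - y \<in> topspace T" using BE by (intro diff_in) auto
      moreover have "p (x - y) < 1" using \<C>(3) D(1) xy by simp
      ultimately show "x - y \<in> U" using p(2) by blast
    qed
    ultimately show ?thesis by blast
  qed
  moreover have "eventually (\<lambda>x. x \<in> topspace T) F"
    by (rule eventually_mono[OF ev[of B]]) (use BE in auto)
  ultimately obtain l where l: "limitin T (\<lambda>x. x) l F"
    using comp F(2) unfolding tvs_complete_def by blast
  have "l \<in> C" if "C \<in> insert B \<U>" for C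
    using limitin_closedin[OF l, of C] ev[OF that] closed B that F(2) by blast
  then show "B \<inter> \<Inter>\<U> \<noteq> {}" by blast
qed

lemma nuclear_closed_bounded_imp_compactin:
  assumes "nuclear_space scale T" "tvs_complete T" "closedin T B" "tvs_bounded scale T B"
  shows "compactin T B"
proof (rule complete_precompact_closed_imp_compactin[OF assms(2,3)])
  fix p assume "cseminorm p"
  from nuclear_bounded_imp_precompact[OF assms(1,4) this zero_less_one]
  show "\<exists>\<C>. finite \<C> \<and> B \<subseteq> \<Union>\<C> \<and> (\<forall>D\<in>\<C>. \<forall>x\<in>D. \<forall>y\<in>D. p (x - y) < 1)" by metis
qed

text \<open>
  By the bipolar theorem this is the closed absolutely convex hull of \<open>B \<union> {0}\<close>.  Describing it by seminorms
  makes closedness, absolute convexity and boundedness immediate.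
\<close>

definition seminorm_hull :: "'a set \<Rightarrow> 'a set"
  where "seminorm_hull B = {x \<in> topspace T. \<forall>p M. cseminorm p \<longrightarrow> 0 \<le> M \<longrightarrow> (\<forall>b\<in>B. p b \<le> M) \<longrightarrow> p x \<le> M}"

lemma seminorm_hull_subset: "B \<subseteq> topspace T \<Longrightarrow> B \<subseteq> seminorm_hull B"
  by (auto simp: seminorm_hull_def)

lemma seminorm_hull_mono: "A \<subseteq> B \<Longrightarrow> seminorm_hull A \<subseteq> seminorm_hull B"
  unfolding seminorm_hull_def by blast

lemma zero_in_seminorm_hull: "0 \<in> seminorm_hull B"
  by (auto simp: seminorm_hull_def cseminorm_zero)

lemma absolutely_convex_seminorm_hull: "absolutely_convex scale (seminorm_hull B)"
  unfolding absolutely_convex_def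
proof (intro ballI allI impI)
  fix x y and a b :: 'k
  assume x: "x \<in> seminorm_hull B" and y: "y \<in> seminorm_hull B" and ab: "norm a + norm b \<le> 1"
  have E: "x \<in> topspace T" "y \<in> topspace T" using x y by (auto simp: seminorm_hull_def)
  have "p (scale a x + scale b y) \<le> M" if p: "cseminorm p" "0 \<le> M" "\<forall>b\<in>B. p b \<le> M" for p M
  proof -
    have le: "p x \<le> M" "p y \<le> M" using x y p by (auto simp: seminorm_hull_def)
    have "p (scale a x + scale b y) \<le> norm a * p x + norm b * p y"
      using cseminorm_add[OF p(1) scale_in[OF E(1)] scale_in[OF E(2)], of a b]
        cseminorm_scale[OF p(1) E(1)] cseminorm_scale[OF p(1) E(2)] by simp
    also have "\<dots> \<le> norm a * M + norm b * M" using le by (intro add_mono mult_left_mono) auto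
    also have "\<dots> \<le> M" using mult_right_mono[OF ab p(2)] by (simp add: distrib_right)
    finally show ?thesis .
  qed
  then show "scale a x + scale b y \<in> seminorm_hull B"
    using E by (simp add: seminorm_hull_def add_in scale_in)
qed

lemma closedin_seminorm_hull: "closedin T (seminorm_hull B)"
proof -
  let ?I = "{(p, M). cseminorm p \<and> 0 \<le> M \<and> (\<forall>b\<in>B. p b \<le> M)}"
  have "seminorm_hull B = topspace T \<inter> (\<Inter>(p, M)\<in>?I. {x \<in> topspace T. p x \<in> {..M}})"
    by (auto simp: seminorm_hull_def)
  also have "\<dots> = \<Inter>(insert (topspace T) ((\<lambda>(p, M). {x \<in> topspace T. p x \<in> {..M}}) ` ?I))" by auto
  also have "closedin T \<dots>"
  proof (rule closedin_Inter)
    fix S assume "S \<in> insert (topspace T) ((\<lambda>(p, M). {x \<in> topspace T. p x \<in> {..M}}) ` ?I)"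
    then consider "S = topspace T" | p M where "cseminorm p" "S = {x \<in> topspace T. p x \<in> {..M}}" by auto
    then show "closedin T S"
    proof cases
      case 2
      then show ?thesis
        using closedin_continuous_map_preimage[OF cseminorm_continuous[OF 2(1)], of "{..M}"] by simp
    qed simp
  qed auto
  finally show ?thesis .
qed

lemma tvs_bounded_seminorm_hull:
  assumes "tvs_bounded scale T B" shows "tvs_bounded scale T (seminorm_hull B)"
  unfolding tvs_bounded_iff
proof (intro conjI allI impI)
  show "seminorm_hull B \<subseteq> topspace T" by (auto simp: seminorm_hull_def)
  fix p assume p: "cseminorm p"
  then obtain M where M: "\<forall>b\<in>B. p b \<le> M" using assms unfolding tvs_bounded_iff by blast
  then have "\<forall>b\<in>B. p b \<le> \<bar>M\<bar>" by force
  then have "\<forall>x\<in>seminorm_hull B. p x \<le> \<bar>M\<bar>" using p unfolding seminorm_hull_def by simp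
  then show "\<exists>M. \<forall>x\<in>seminorm_hull B. p x \<le> M" by blast
qed

lemma tvs_bounded_UN_finite:
  fixes B :: "nat \<Rightarrow> 'a set"
  assumes "\<And>i. tvs_bounded scale T (B i)" shows "tvs_bounded scale T (\<Union>i\<le>n. B i)"
proof (induction n)
  case (Suc n)
  have eq: "(\<Union>i\<le>Suc n. B i) = (\<Union>i\<le>n. B i) \<union> B (Suc n)" by (auto simp: le_Suc_eq)
  show ?case unfolding eq tvs_bounded_iff
  proof (intro conjI allI impI)
    show "(\<Union>i\<le>n. B i) \<union> B (Suc n) \<subseteq> topspace T" using Suc assms[of "Suc n"] by (simp add: tvs_bounded_def)
    fix p assume p: "cseminorm p"
    obtain M where M: "\<forall>x\<in>(\<Union>i\<le>n. B i). p x \<le> M" using Suc p unfolding tvs_bounded_iff by blast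
    obtain M' where M': "\<forall>x\<in>B (Suc n). p x \<le> M'" using assms[of "Suc n"] p unfolding tvs_bounded_iff by blast
    have "\<forall>x\<in>(\<Union>i\<le>n. B i) \<union> B (Suc n). p x \<le> max M M'" using M M' by (auto simp: le_max_iff_disj)
    then show "\<exists>M. \<forall>x\<in>(\<Union>i\<le>n. B i) \<union> B (Suc n). p x \<le> M" by blast
  qed
qed (use assms in simp)

lemma tvs_bounded_singleton: "x \<in> topspace T \<Longrightarrow> tvs_bounded scale T {x}"
  unfolding tvs_bounded_iff by auto

text \<open>
  The hulls of finite unions from a fundamental sequence of bounded sets; they are closed and bounded,
  hence compact by nuclearity and completeness.
\<close>

lemma compact_exhaustion:
  assumes "complete_nuclear_DF_space scale T"
  obtains K :: "nat \<Rightarrow> 'a set" where "\<And>i. compactin T (K i)" "\<And>i. absolutely_convex scale (K i)"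
    "\<And>i. 0 \<in> K i" "mono K" "\<And>C. tvs_bounded scale T C \<Longrightarrow> \<exists>i. C \<subseteq> K i"
proof -
  obtain B :: "nat \<Rightarrow> 'a set" where B: "\<And>i. tvs_bounded scale T (B i)"
    "\<And>C. tvs_bounded scale T C \<Longrightarrow> \<exists>i. C \<subseteq> B i"
    using assms unfolding complete_nuclear_DF_space_def DF_space_def by blast
  define K where "K n = seminorm_hull (\<Union>i\<le>n. B i)" for n
  have bd: "tvs_bounded scale T (\<Union>i\<le>n. B i)" for n by (rule tvs_bounded_UN_finite) (rule B)
  have "compactin T (K n)" for n unfolding K_def
    using assms by (intro nuclear_closed_bounded_imp_compactin closedin_seminorm_hull tvs_bounded_seminorm_hull bd)
      (simp_all add: complete_nuclear_DF_space_def)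
  moreover have "mono K" unfolding K_def by (intro monoI seminorm_hull_mono UN_mono) auto
  moreover have "\<exists>i. C \<subseteq> K i" if C: "tvs_bounded scale T C" for C
  proof -
    obtain i where "C \<subseteq> B i" using B(2) C by blast
    moreover have "B i \<subseteq> (\<Union>j\<le>i. B j)" by blast
    moreover have "(\<Union>j\<le>i. B j) \<subseteq> K i"
      unfolding K_def using bd[of i] by (intro seminorm_hull_subset) (simp add: tvs_bounded_def)
    ultimately show ?thesis by blast
  qed
  ultimately show thesis
    by (intro that[of K]) (auto simp: K_def absolutely_convex_seminorm_hull zero_in_seminorm_hull)
qed

end


section \<open>Complete nuclear DF-spaces are compactly generated\<close>

context locally_convex_space
begin

lemma absolutely_convex_balanced:
  assumes "absolutely_convex scale C" "x \<in> C" "norm a \<le> 1"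
  shows "scale a x \<in> C"
proof -
  have "scale a x + scale 0 x \<in> C"
    using assms(1)[unfolded absolutely_convex_def, rule_format, of x x a 0] assms(2,3) by simp
  then show ?thesis by simp
qed

lemma zero_nbhd_mono:
  assumes "zero_nbhd T U" "U \<subseteq> V" "V \<subseteq> topspace T"
  shows "zero_nbhd T V"
proof -
  obtain W where "openin T W" "0 \<in> W" "W \<subseteq> U" using assms(1) unfolding zero_nbhd_def by blast
  then show ?thesis using assms(2,3) unfolding zero_nbhd_def by blast
qed

lemma separated_compact_nbhd:
  assumes L: "compactin T L" "L \<subseteq> V" and K: "compactin T K" and W: "openin T W" "K \<inter> V = K \<inter> W"
  obtains p where "cseminorm p" "\<And>l y. l \<in> L \<Longrightarrow> y \<in> K \<Longrightarrow> p (y - l) < 1 \<Longrightarrow> y \<in> V"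
proof -
  have "closedin T (K - W)"
    using closedin_diff[OF compactin_imp_closedin[OF hausdorff K] W(1)] .
  then have "openin T (topspace T - (K - W))" by blast
  moreover have "L \<subseteq> topspace T - (K - W)"
    using L W(2) compactin_subset_topspace[OF L(1)] by blast
  ultimately obtain p where p: "cseminorm p"
    "\<And>l y. l \<in> L \<Longrightarrow> y \<in> topspace T \<Longrightarrow> p (y - l) < 1 \<Longrightarrow> y \<in> topspace T - (K - W)"
    using compact_uniform_nbhd[OF L(1)] by blast
  have "y \<in> V" if "l \<in> L" "y \<in> K" "p (y - l) < 1" for l y
    using p(2)[of l y] that W(2) compactin_subset_topspace[OF K] by blast
  with p(1) show thesis by (rule that)
qed

text \<open>
  The points at \<open>p\<close>-distance at most \<open>1/2\<close> from \<open>L\<close>, with the distance to a set expressed without an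
  infimum.  The non-strict bound makes the set closed.
\<close>

definition thickening :: "('a \<Rightarrow> real) \<Rightarrow> 'a set \<Rightarrow> 'a set"
  where "thickening p L = {x \<in> topspace T. \<forall>e>1/2. \<exists>l\<in>L. p (x - l) < e}"

lemma thickeningI:
  assumes "x \<in> topspace T" "l \<in> L" "p (x - l) \<le> 1/2"
  shows "x \<in> thickening p L"
  using assms unfolding thickening_def by force

lemma thickeningE:
  assumes "x \<in> thickening p L"
  obtains l where "x \<in> topspace T" "l \<in> L" "p (x - l) < 1"
proof -
  have "(1::real) > 1/2" by simp
  then show thesis using assms that unfolding thickening_def by blast
qed

lemma closedin_thickening:
  assumes p: "cseminorm p" and L: "L \<subseteq> topspace T"
  shows "closedin T (thickening p L)"
proof -
  have "openin T (topspace T - thickening p L)"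
    unfolding openin_iff_seminorm
  proof (intro conjI ballI)
    fix x assume "x \<in> topspace T - thickening p L"
    then obtain e where x: "x \<in> topspace T" and e: "e > 1/2" "\<And>l. l \<in> L \<Longrightarrow> e \<le> p (x - l)"
      unfolding thickening_def by (auto simp: not_less)
    define d where "d = (e - 1/2) / 2"
    have d: "d > 0" using e by (simp add: d_def)
    have "y \<in> topspace T - thickening p L" if y: "y \<in> topspace T" "inverse d * p (y - x) < 1" for y
    proof -
      have lt: "p (y - x) < d" using y(2) d by (simp add: field_simps)
      have "\<not> p (y - l) < 1/2 + d" if l: "l \<in> L" for l
      proof -
        have "p (x - l) \<le> p (x - y) + p (y - l)" using cseminorm_triangle[OF p x y(1)] l L by blast
        also have "p (x - y) = p (y - x)" by (rule cseminorm_commute[OF p x y(1)])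
        finally have "p (x - l) \<le> p (y - x) + p (y - l)" .
        moreover have "e = 1/2 + 2 * d" by (simp add: d_def field_simps)
        ultimately show ?thesis using e(2)[OF l] lt by linarith
      qed
      moreover have "1/2 + d > 1/2" using d by simp
      ultimately show ?thesis using y(1) unfolding thickening_def by blast
    qed
    then show "\<exists>q. cseminorm q \<and> (\<forall>y\<in>topspace T. q (y - x) < 1 \<longrightarrow> y \<in> topspace T - thickening p L)"
      using cseminorm_scaleR[OF p, of "inverse d"] d by (intro exI[of _ "\<lambda>x. inverse d * p x"]) simp
  qed blast
  then show ?thesis by (auto simp: closedin_def thickening_def)
qed

lemma absolutely_convex_thickening:
  assumes p: "cseminorm p" and L: "L \<subseteq> topspace T" "absolutely_convex scale L"
  shows "absolutely_convex scale (thickening p L)"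
  unfolding absolutely_convex_def
proof (intro ballI allI impI)
  fix x y and a b :: 'k
  assume x: "x \<in> thickening p L" and y: "y \<in> thickening p L" and ab: "norm a + norm b \<le> 1"
  have E: "x \<in> topspace T" "y \<in> topspace T" using x y by (auto simp: thickening_def)
  have "\<exists>l\<in>L. p (scale a x + scale b y - l) < e" if e: "e > 1/2" for e
  proof -
    obtain l where l: "l \<in> L" "p (x - l) < e" using x e unfolding thickening_def by blast
    obtain m where m: "m \<in> L" "p (y - m) < e" using y e unfolding thickening_def by blast
    have d: "x - l \<in> topspace T" "y - m \<in> topspace T" using l m L E diff_in by blast+
    have "scale a x + scale b y - (scale a l + scale b m) = scale a (x - l) + scale b (y - m)"
      by (simp add: scale_right_diff_distrib)
    then have "p (scale a x + scale b y - (scale a l + scale b m)) \<le> norm a * p (x - l) + norm b * p (y - m)"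
      using cseminorm_add[OF p scale_in[OF d(1)] scale_in[OF d(2)], of a b]
        cseminorm_scale[OF p d(1), of a] cseminorm_scale[OF p d(2), of b] by simp
    also have "\<dots> \<le> norm a * max (p (x - l)) (p (y - m)) + norm b * max (p (x - l)) (p (y - m))"
      by (intro add_mono mult_left_mono) auto
    also have "\<dots> = (norm a + norm b) * max (p (x - l)) (p (y - m))" by (simp add: distrib_right)
    also have "\<dots> \<le> 1 * max (p (x - l)) (p (y - m))"
      using ab cseminorm_nonneg[OF p d(1)] by (intro mult_right_mono) (auto simp: le_max_iff_disj)
    also have "\<dots> < e" using l m by simp
    finally have "p (scale a x + scale b y - (scale a l + scale b m)) < e" .
    moreover have "scale a l + scale b m \<in> L" using L(2) l m ab unfolding absolutely_convex_def by blast
    ultimately show ?thesis by blast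
  qed
  then show "scale a x + scale b y \<in> thickening p L"
    using E by (simp add: thickening_def add_in scale_in)
qed

lemma zero_nbhd_thickening:
  assumes p: "cseminorm p" and L: "0 \<in> L"
  shows "zero_nbhd T (thickening p L)"
proof -
  have "{x \<in> topspace T. p x < 1/2} \<subseteq> thickening p L" using L by (auto intro: thickeningI)
  moreover have "thickening p L \<subseteq> topspace T" by (auto simp: thickening_def)
  ultimately show ?thesis
    using zero_nbhd_mono[OF zero_nbhd_seminorm_ball[OF p, of "1/2"]] by simp
qed

text \<open>
  The new set is \<open>L + e K\<close>.  All these sets for \<open>e \<le> 1\<close> lie in the compact set \<open>L + K\<close>, on which \<open>V\<close> is
  relatively open, so a small \<open>e\<close> keeps \<open>L + e K\<close> inside \<open>V\<close>.
\<close>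

lemma compact_absolutely_convex_enlarge:
  assumes L: "compactin T L" "absolutely_convex scale L" "0 \<in> L" "L \<subseteq> V"
    and K: "compactin T K" "absolutely_convex scale K" "0 \<in> K"
    and V: "\<And>C. compactin T C \<Longrightarrow> \<exists>W. openin T W \<and> C \<inter> V = C \<inter> W"
  obtains L' e where "compactin T L'" "absolutely_convex scale L'" "0 \<in> L'" "L' \<subseteq> V"
    "L \<subseteq> L'" "0 < e" "scale (of_real e) ` K \<subseteq> L'"
proof -
  have T: "L \<subseteq> topspace T" "K \<subseteq> topspace T"
    using L(1) K(1) compactin_subset_topspace by blast+
  let ?S = "(\<lambda>(x, y). x + y) ` (L \<times> K)"
  have S: "compactin T ?S" using L K by (intro compactin_set_add) auto
  obtain W where W: "openin T W" "?S \<inter> V = ?S \<inter> W" using V[OF S] by blast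
  obtain p where p: "cseminorm p" "\<And>l y. l \<in> L \<Longrightarrow> y \<in> ?S \<Longrightarrow> p (y - l) < 1 \<Longrightarrow> y \<in> V"
    using separated_compact_nbhd[OF L(1,4) S W] by blast
  obtain M0 where M0: "\<And>x. x \<in> K \<Longrightarrow> p x \<le> M0"
    using compactin_imp_tvs_bounded[OF K(1)] p(1) unfolding tvs_bounded_iff by blast
  define M e where "M = \<bar>M0\<bar>" and "e = inverse (M + 1)"
  have M: "0 \<le> M" "\<And>x. x \<in> K \<Longrightarrow> p x \<le> M" using M0 by (fastforce simp: M_def)+
  have e: "0 < e" "e \<le> 1" "e * M < 1" using M(1) by (auto simp: e_def field_simps)
  let ?eK = "scale (of_real e) ` K"
  let ?L' = "(\<lambda>(x, y). x + y) ` (L \<times> ?eK)"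
  have "compactin T ?L'"
    by (intro compactin_set_add L(1) image_compactin[OF K(1) continuous_map_dilation])
  moreover have "absolutely_convex scale ?L'"
    unfolding absolutely_convex_def
  proof (intro ballI allI impI)
    fix x y and a b :: 'k
    assume "x \<in> ?L'" "y \<in> ?L'" and ab: "norm a + norm b \<le> 1"
    then obtain l k l' k' where lk: "l \<in> L" "k \<in> K" "l' \<in> L" "k' \<in> K"
      and xy: "x = l + scale (of_real e) k" "y = l' + scale (of_real e) k'" by auto
    have "scale a l + scale b l' \<in> L" "scale a k + scale b k' \<in> K"
      using L(2) K(2) lk ab unfolding absolutely_convex_def by blast+
    moreover have "scale a x + scale b y =
        (scale a l + scale b l') + scale (of_real e) (scale a k + scale b k')"
    proof -
      have "scale c (scale (of_real e) u) = scale (of_real e) (scale c u)" for c u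
        by (simp add: mult.commute)
      then show ?thesis by (simp only: xy scale_right_distrib ac_simps)
    qed
    ultimately show "scale a x + scale b y \<in> ?L'"
      by (intro image_eqI[where x = "(scale a l + scale b l', scale (of_real e) (scale a k + scale b k'))"]) auto
  qed
  moreover have "0 \<in> ?L'" and "L \<subseteq> ?L'" and "?eK \<subseteq> ?L'"
  proof -
    have z: "0 \<in> ?eK" using K(3) by (force simp: image_iff)
    show "L \<subseteq> ?L'"
    proof
      fix l assume "l \<in> L"
      then have "(l, 0) \<in> L \<times> ?eK" using z by blast
      then show "l \<in> ?L'" by (metis (no_types, lifting) add.right_neutral case_prod_conv imageI)
    qed
    then show "0 \<in> ?L'" using L(3) by blast
    show "?eK \<subseteq> ?L'"
    proof
      fix k assume "k \<in> ?eK"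
      then have "(0, k) \<in> L \<times> ?eK" using L(3) by blast
      then show "k \<in> ?L'" by (metis (no_types, lifting) add.left_neutral case_prod_conv imageI)
    qed
  qed
  moreover have "?L' \<subseteq> V"
  proof
    fix y assume "y \<in> ?L'"
    then obtain l k where lk: "l \<in> L" "k \<in> K" and y: "y = l + scale (of_real e) k" by auto
    have "scale (of_real e) k \<in> K"
      using absolutely_convex_balanced[OF K(2) lk(2)] e by simp
    then have "y \<in> ?S" using lk y by auto
    moreover have "p (y - l) < 1"
    proof -
      have "p (y - l) = e * p k"
        using cseminorm_scale[OF p(1), of k "of_real e"] lk T e by (auto simp: y)
      also have "\<dots> \<le> e * M" using M(2)[OF lk(2)] e by (intro mult_left_mono) auto
      finally show ?thesis using e by simp
    qed
    ultimately show "y \<in> V" using p(2) lk by blast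
  qed
  ultimately show thesis using e(1) by (intro that[of ?L' e])
qed

text \<open>
  A construction in the style of Banach and Dieudonne.  Let \<open>K i\<close> exhaust the space.  Starting from
  \<open>{0}\<close>, enlarge successively to compact absolutely convex sets \<open>L i \<subseteq> V\<close> so that \<open>L (Suc i)\<close> contains
  a multiple of \<open>K i\<close>.  A closed thickening \<open>N i\<close> of \<open>L i\<close> still avoids the compact set \<open>K i - V\<close>.
  Then \<open>\<Inter>i. N i\<close> lies in \<open>V\<close>, because every point lies in some \<open>K i\<close>.  It is bornivorous: a bounded
  set lies in some \<open>K j\<close>, it is absorbed by all \<open>L i\<close> with \<open>i > j\<close> simultaneously, and the finitely
  many remaining \<open>N i\<close> are neighbourhoods of \<open>0\<close>.  The \<open>DF\<close> property makes the intersection a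
  neighbourhood of \<open>0\<close>.
\<close>

lemma compactly_open_imp_zero_nbhd:
  assumes DF: "complete_nuclear_DF_space scale T" and V0: "0 \<in> V" and VT: "V \<subseteq> topspace T"
    and V: "\<And>C. compactin T C \<Longrightarrow> \<exists>W. openin T W \<and> C \<inter> V = C \<inter> W"
  shows "zero_nbhd T V"
proof -
  obtain K :: "nat \<Rightarrow> 'a set" where K: "\<And>i. compactin T (K i)" "\<And>i. absolutely_convex scale (K i)"
    "\<And>i. 0 \<in> K i" "mono K" "\<And>C. tvs_bounded scale T C \<Longrightarrow> \<exists>i. C \<subseteq> K i"
    using compact_exhaustion[OF DF] by blast
  define P where "P L \<longleftrightarrow> compactin T L \<and> absolutely_convex scale L \<and> 0 \<in> L \<and> L \<subseteq> V" for L
  have "\<exists>L :: nat \<Rightarrow> 'a set. \<forall>i. P (L i) \<and> (L i \<subseteq> L (Suc i) \<and> (\<exists>e>0. scale (of_real e) ` K i \<subseteq> L (Suc i)))"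
  proof (rule dependent_nat_choice)
    show "\<exists>L. P L" using V0 by (intro exI[of _ "{0}"]) (simp add: P_def absolutely_convex_def)
    fix L :: "'a set" and i :: nat assume "P L"
    then have L: "compactin T L" "absolutely_convex scale L" "0 \<in> L" "L \<subseteq> V" by (simp_all add: P_def)
    obtain L' e where "compactin T L'" "absolutely_convex scale L'" "0 \<in> L'" "L' \<subseteq> V"
      "L \<subseteq> L'" "0 < e" "scale (of_real e) ` K i \<subseteq> L'"
      using compact_absolutely_convex_enlarge[OF L K(1) K(2) K(3) V] by blast
    then show "\<exists>L'. P L' \<and> (L \<subseteq> L' \<and> (\<exists>e>0. scale (of_real e) ` K i \<subseteq> L'))"
      unfolding P_def by blast
  qed
  then obtain L :: "nat \<Rightarrow> 'a set" where L: "\<And>i. P (L i)" "\<And>i. L i \<subseteq> L (Suc i)"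
    and LK: "\<And>i. \<exists>e>0. scale (of_real e) ` K i \<subseteq> L (Suc i)" by metis
  have L': "compactin T (L i)" "absolutely_convex scale (L i)" "0 \<in> L i" "L i \<subseteq> V" for i
    using L(1)[of i] by (simp_all add: P_def)
  have LT: "L i \<subseteq> topspace T" for i using L'(4) VT by blast
  have L_mono: "L i \<subseteq> L j" if "i \<le> j" for i j using that L(2) by (rule lift_Suc_mono_le[rotated])
  have "\<exists>p. cseminorm p \<and> (\<forall>l\<in>L i. \<forall>y\<in>K i. p (y - l) < 1 \<longrightarrow> y \<in> V)" for i
  proof -
    obtain W where W: "openin T W" "K i \<inter> V = K i \<inter> W" using V[OF K(1)] by blast
    show ?thesis using separated_compact_nbhd[OF L'(1) L'(4) K(1) W] by metis
  qed
  then obtain p where p: "\<And>i. cseminorm (p i)"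
    "\<And>i l y. l \<in> L i \<Longrightarrow> y \<in> K i \<Longrightarrow> p i (y - l) < 1 \<Longrightarrow> y \<in> V" by metis
  define N where "N i = thickening (p i) (L i)" for i
  have "zero_nbhd T (N i) \<and> closedin T (N i) \<and> absolutely_convex scale (N i)" for i
    unfolding N_def
    by (intro conjI zero_nbhd_thickening closedin_thickening absolutely_convex_thickening p L' LT)
  moreover have "bornivorous scale T (\<Inter>i. N i)"
    unfolding bornivorous_def
  proof (intro allI impI)
    fix B assume B: "tvs_bounded scale T B"
    then obtain j where j: "B \<subseteq> K j" using K(5) by blast
    have BT: "B \<subseteq> topspace T" using B by (simp add: tvs_bounded_def)
    obtain e where e: "e > 0" "scale (of_real e) ` K j \<subseteq> L (Suc j)" using LK by blast
    have "cseminorm (\<lambda>x. \<Sum>i\<le>j. p i x)" by (intro cseminorm_sum p) auto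
    then obtain M where M: "\<And>x. x \<in> B \<Longrightarrow> (\<Sum>i\<le>j. p i x) \<le> M" using B unfolding tvs_bounded_iff by blast
    \<comment> \<open>The first bound serves the sets \<open>N i\<close> with \<open>i > j\<close>, the second those with \<open>i \<le> j\<close>.\<close>
    define r where "r = max (inverse e) (2 * \<bar>M\<bar> + 1)"
    have "x \<in> scale a ` (\<Inter>i. N i)" if a: "r \<le> norm a" and x: "x \<in> B" for a x
    proof -
      have a1: "inverse e \<le> norm a" and a2: "2 * \<bar>M\<bar> + 1 \<le> norm a" using a by (simp_all add: r_def)
      have a0: "norm a > 0" "a \<noteq> 0" using a2 by auto
      have xT: "x \<in> topspace T" using x BT by blast
      let ?y = "scale (inverse a) x"
      have yT: "?y \<in> topspace T" using xT by (rule scale_in)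
      have "?y \<in> N i" for i
      proof (cases "i \<le> j")
        case True
        have "p i x \<le> (\<Sum>i\<le>j. p i x)"
          using True by (intro member_le_sum) (auto intro: cseminorm_nonneg[OF p(1) xT])
        then have "2 * p i x \<le> norm a" using M[OF x] a2 by linarith
        moreover have "p i ?y = p i x / norm a"
          using cseminorm_scale[OF p(1) xT] by (simp add: norm_inverse divide_inverse mult.commute)
        ultimately have "p i (?y - 0) \<le> 1/2" using a0 by (simp add: divide_le_eq)
        then show ?thesis unfolding N_def using yT L'(3) by (rule_tac thickeningI)
      next
        case False
        have "norm (inverse (a * of_real e)) \<le> 1"
        proof -
          have "1 \<le> norm a * e" using a1 e(1) by (simp add: field_simps)
          then show ?thesis
            using le_imp_inverse_le[of 1 "norm a * e"] e(1) by (simp add: norm_inverse norm_mult)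
        qed
        then have "scale (inverse (a * of_real e)) x \<in> K j"
          using absolutely_convex_balanced[OF K(2)] x j by blast
        then have "scale (of_real e) (scale (inverse (a * of_real e)) x) \<in> L (Suc j)" using e(2) by blast
        moreover have "scale (of_real e) (scale (inverse (a * of_real e)) x) = ?y" using e(1) by simp
        ultimately have "?y \<in> L (Suc j)" by (simp only:)
        then have "?y \<in> L i" using L_mono[of "Suc j" i] False by (auto simp only: not_le Suc_le_eq)
        then show ?thesis unfolding N_def using yT p(1) by (intro thickeningI[of _ ?y]) (auto simp: cseminorm_zero)
      qed
      then have "?y \<in> (\<Inter>i. N i)" by blast
      moreover have "x = scale a ?y" using a0 by simp
      ultimately show ?thesis by blast
    qed
    moreover have "r > 0" using e(1) by (simp add: r_def less_max_iff_disj)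
    ultimately show "absorbs scale (\<Inter>i. N i) B" unfolding absorbs_def by blast
  qed
  ultimately have "zero_nbhd T (\<Inter>i. N i)"
    using DF unfolding complete_nuclear_DF_space_def DF_space_def by blast
  moreover have "(\<Inter>i. N i) \<subseteq> V"
  proof
    fix x assume x: "x \<in> (\<Inter>i. N i)"
    then have "x \<in> topspace T" by (auto simp: N_def thickening_def)
    then obtain m where m: "x \<in> K m" using K(5)[OF tvs_bounded_singleton] by blast
    obtain l where "l \<in> L m" "p m (x - l) < 1"
      using x thickeningE[of x "p m" "L m"] unfolding N_def by blast
    then show "x \<in> V" using p(2) m by blast
  qed
  ultimately show ?thesis using VT by (rule zero_nbhd_mono)
qed

theorem complete_nuclear_DF_imp_k_space:
  assumes DF: "complete_nuclear_DF_space scale T"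
  shows "k_space T"
  unfolding k_space_open
proof (intro allI impI; elim conjE)
  fix S assume S: "S \<subseteq> topspace T" and op: "\<forall>K. compactin T K \<longrightarrow> openin (subtopology T K) (K \<inter> S)"
  show "openin T S"
    unfolding openin_iff_seminorm
  proof (intro conjI ballI S)
    fix x assume x: "x \<in> S"
    then have xT: "x \<in> topspace T" using S by blast
    let ?t = "\<lambda>y. y + x"
    let ?V = "{y \<in> topspace T. ?t y \<in> S}"
    have "zero_nbhd T ?V"
    proof (rule compactly_open_imp_zero_nbhd[OF DF])
      fix C assume C: "compactin T C"
      have "compactin T (?t ` C)" by (rule image_compactin[OF C continuous_map_translation[OF xT]])
      then have "openin (subtopology T (?t ` C)) (?t ` C \<inter> S)" using op by blast
      then obtain W where W: "openin T W" "?t ` C \<inter> S = W \<inter> ?t ` C" unfolding openin_subtopology by blast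
      have "openin T {y \<in> topspace T. ?t y \<in> W}"
        by (rule openin_continuous_map_preimage[OF continuous_map_translation[OF xT] W(1)])
      moreover have "C \<inter> ?V = C \<inter> {y \<in> topspace T. ?t y \<in> W}" using W(2) by blast
      ultimately show "\<exists>W. openin T W \<and> C \<inter> ?V = C \<inter> W" by blast
    qed (use x in auto)
    then obtain p where p: "cseminorm p" "{y \<in> topspace T. p y < 1} \<subseteq> ?V" unfolding zero_nbhd_iff by blast
    have "y \<in> S" if "y \<in> topspace T" "p (y - x) < 1" for y
      using p(2) that diff_in[OF that(1) xT] by force
    then show "\<exists>p. cseminorm p \<and> (\<forall>y\<in>topspace T. p (y - x) < 1 \<longrightarrow> y \<in> S)" using p(1) by blast
  qed
qed

end


section \<open>Lifting compact sets\<close>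

context locally_convex_space
begin

text \<open>
  Baire's theorem is applied to the compact Hausdorff space \<open>K\<close> itself, which avoids the Banach space
  spanned by \<open>K\<close>.  Some \<open>C i\<close> contains a relative neighbourhood in \<open>K\<close> of a point \<open>x0\<close>.  By convexity
  and boundedness of \<open>K\<close> this neighbourhood contains all \<open>(1 - t) x0 + t y\<close> with \<open>y \<in> K\<close> for one small
  \<open>t\<close>; half the difference of two such points, the second with \<open>y = 0\<close>, is \<open>(t / 2) y\<close>.
\<close>

lemma compact_absorbed_by_cover:
  fixes C :: "nat \<Rightarrow> 'a set"
  assumes K: "compactin T K" "absolutely_convex scale K" "0 \<in> K"
    and C: "\<And>i. closedin T (C i)" "\<And>i. absolutely_convex scale (C i)" and cover: "K \<subseteq> (\<Union>i. C i)"
  obtains i r where "0 < r" "\<And>x. x \<in> K \<Longrightarrow> scale (of_real r) x \<in> C i"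
proof -
  let ?X = "subtopology T K"
  have KT: "K \<subseteq> topspace T" using K(1) compactin_subset_topspace by blast
  have "compact_space ?X" "Hausdorff_space ?X"
    using K(1) hausdorff by (auto simp: compact_space_subtopology Hausdorff_space_subtopology)
  then have X: "locally_compact_space ?X" "regular_space ?X"
    by (auto simp: compact_imp_locally_compact_space compact_Hausdorff_imp_regular_space)
  have top: "topspace ?X = K" using KT by auto
  have "\<exists>i. ?X interior_of (K \<inter> C i) \<noteq> {}"
  proof (rule ccontr)
    assume "\<not> ?thesis"
    then have "?X interior_of \<Union>(range (\<lambda>i. K \<inter> C i)) = {}"
      using X C(1) by (intro Baire_category_alt) (auto intro: closedin_subtopology_Int_closed)
    moreover have "\<Union>(range (\<lambda>i. K \<inter> C i)) = topspace ?X" using cover top by auto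
    ultimately show False using K(3) top by (metis empty_iff interior_of_topspace)
  qed
  then obtain i x0 where x0: "x0 \<in> ?X interior_of (K \<inter> C i)" by blast
  have "openin ?X (?X interior_of (K \<inter> C i))" by simp
  then obtain W where W: "openin T W" "?X interior_of (K \<inter> C i) = W \<inter> K" unfolding openin_subtopology by blast
  have WC: "W \<inter> K \<subseteq> C i" using interior_of_subset[of ?X "K \<inter> C i"] W(2) by blast
  have x0W: "x0 \<in> W" "x0 \<in> K" using x0 W(2) by auto
  obtain p where p: "cseminorm p" "\<forall>y\<in>topspace T. p (y - x0) < 1 \<longrightarrow> y \<in> W"
    using W(1) x0W(1) unfolding openin_iff_seminorm by blast
  obtain M0 where M0: "\<And>x. x \<in> K \<Longrightarrow> p x \<le> M0"
    using compactin_imp_tvs_bounded[OF K(1)] p(1) unfolding tvs_bounded_iff by blast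
  define M t where "M = \<bar>M0\<bar>" and "t = inverse (2 * M + 1)"
  have M: "0 \<le> M" "\<And>x. x \<in> K \<Longrightarrow> p x \<le> M" using M0 by (fastforce simp: M_def)+
  have t: "0 < t" "t \<le> 1" "t * (2 * M) < 1" using M(1) by (auto simp: t_def field_simps)
  define z where "z y = scale (of_real (1 - t)) x0 + scale (of_real t) y" for y
  have norms: "norm (of_real (1 - t) :: 'k) + norm (of_real t :: 'k) \<le> 1"
    using t by (simp only: norm_of_real)
  have zC: "z y \<in> C i" if y: "y \<in> K" for y
  proof -
    have yT: "y \<in> topspace T" "x0 \<in> topspace T" using y x0W KT by auto
    have zK: "z y \<in> K"
      unfolding z_def using K(2) x0W(2) y norms unfolding absolutely_convex_def by blast
    have "z y - x0 = scale (of_real t) (y - x0)"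
      by (simp add: z_def scale_left_diff_distrib scale_right_diff_distrib)
    then have "p (z y - x0) = t * p (y - x0)"
      using cseminorm_scale[OF p(1) diff_in[OF yT], of "of_real t"] t by simp
    also have "\<dots> \<le> t * (2 * M)"
      using cseminorm_diff[OF p(1) yT] M(2)[OF y] M(2)[OF x0W(2)] t by (intro mult_left_mono) auto
    finally have "p (z y - x0) < 1" using t by simp
    then have "z y \<in> W" using p(2) zK KT by blast
    then show ?thesis using zK WC by blast
  qed
  have "scale (of_real (t / 2)) y \<in> C i" if y: "y \<in> K" for y
  proof -
    have half: "norm (1/2 :: 'k) + norm (- (1/2) :: 'k) \<le> 1" by (simp add: norm_divide)
    have "scale (1/2) (z y) + scale (- (1/2)) (z 0) \<in> C i"
      using C(2)[of i] zC[OF y] zC[OF K(3)] half unfolding absolutely_convex_def by blast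
    moreover have "scale (1/2) (z y) + scale (- (1/2)) (z 0) = scale (of_real (t / 2)) y"
      by (simp add: z_def scale_right_distrib)
    ultimately show ?thesis by simp
  qed
  then show thesis using t(1) by (intro that[of "t / 2" i]) auto
qed

end

text \<open>
  If the preimage of \<open>S\<close> is closed and \<open>B\<close> is a compact set over \<open>C\<close>, then \<open>C \<inter> S\<close> is the trace on \<open>C\<close>
  of the compact image of \<open>B \<inter> f -` S\<close>.
\<close>

lemma compact_lifting_imp_quotient_map:
  assumes f: "continuous_map P Q f" and Q: "k_space Q" "Hausdorff_space Q"
    and lift: "\<And>C. compactin Q C \<Longrightarrow> \<exists>B. compactin P B \<and> C \<subseteq> f ` B"
  shows "quotient_map P Q f"
  unfolding quotient_map_closedin
proof (intro conjI allI impI)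
  have "y \<in> f ` topspace P" if "y \<in> topspace Q" for y
    using lift[of "{y}"] that compactin_subset_topspace by fastforce
  then show "f ` topspace P = topspace Q" using f by (auto simp: continuous_map_def)
  fix S assume S: "S \<subseteq> topspace Q"
  let ?R = "{x \<in> topspace P. f x \<in> S}"
  show "closedin P ?R = closedin Q S"
  proof
    assume R: "closedin P ?R"
    have "closedin (subtopology Q C) (C \<inter> S)" if C: "compactin Q C" for C
    proof -
      obtain B where B: "compactin P B" "C \<subseteq> f ` B" using lift[OF C] by blast
      have BP: "B \<subseteq> topspace P" using B(1) compactin_subset_topspace by blast
      have "compactin Q (f ` (B \<inter> ?R))"
        by (rule image_compactin[OF compact_Int_closedin[OF B(1) R] f])
      then have "closedin Q (f ` (B \<inter> ?R))" by (rule compactin_imp_closedin[OF Q(2)])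
      moreover have "C \<inter> S = C \<inter> f ` (B \<inter> ?R)" using B(2) BP by blast
      ultimately show ?thesis by (simp add: closedin_subtopology_Int_closed)
    qed
    then show "closedin Q S" using Q(1) S unfolding k_space by blast
  next
    assume "closedin Q S"
    then show "closedin P ?R" by (rule closedin_continuous_map_preimage[OF f])
  qed
qed


lemma (in locally_convex_space) compactin_dilation:
  assumes B: "compactin T B" "\<And>x. x \<in> B \<Longrightarrow> scale a x \<in> Z"
  shows "compactin (subtopology T Z) (scale a ` B)"
  using image_compactin[OF B(1) continuous_map_dilation] B(2) by (auto simp: compactin_subtopology)

text \<open>
  The open mapping theorem in the form that is needed, with openness replaced by the quotient
  property.  A compact subset of \<open>W\<close> lies in some \<open>K m \<inter> W\<close>, and \<open>W\<close> is the union of the compact absolutely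
  convex images \<open>I i\<close> of the products of the exhausting sets.  By the Baire argument one of the \<open>I i\<close>
  contains a multiple of \<open>K m \<inter> W\<close>, and rescaling gives a compact set over \<open>K m \<inter> W\<close>.  The domain only
  has to be exhausted by compact sets; the topology of the target must be compactly generated, which
  passes to the closed subspace \<open>W\<close>.
\<close>

lemma sum_map_quotient_map:
  fixes s :: "'k::real_normed_field \<Rightarrow> 'a::ab_group_add \<Rightarrow> 'a" and t :: "'k \<Rightarrow> 'b::ab_group_add \<Rightarrow> 'b"
    and u :: "'k \<Rightarrow> 'c::ab_group_add \<Rightarrow> 'c"
  assumes E: "complete_nuclear_DF_space s E" and F: "complete_nuclear_DF_space t F"
    and G: "complete_nuclear_DF_space u G"
    and g: "continuous_linear s u E G g" and h: "continuous_linear t u F G h"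
    and Z: "closedin E Z" "module.subspace s Z" and W: "closedin G W" "module.subspace u W"
    and gZ: "g ` Z \<subseteq> W" and hF: "h ` topspace F \<subseteq> W"
    and surj: "\<And>w. w \<in> W \<Longrightarrow> \<exists>x\<in>Z. \<exists>y\<in>topspace F. w = g x + h y"
  shows "quotient_map (prod_topology (subtopology E Z) F) (subtopology G W) (\<lambda>(x, y). g x + h y)"
    (is "quotient_map ?P ?Q ?f")
proof -
  interpret E: locally_convex_space s E using E by (simp add: complete_nuclear_DF_space_def DF_space_def)
  interpret F: locally_convex_space t F using F by (simp add: complete_nuclear_DF_space_def DF_space_def)
  interpret G: locally_convex_space u G using G by (simp add: complete_nuclear_DF_space_def DF_space_def)
  have ZE: "Z \<subseteq> topspace E" and WG: "W \<subseteq> topspace G" using Z W closedin_subset by auto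
  have g_lin: "g (x + x') = g x + g x'" "g (s a x) = u a (g x)" if "x \<in> topspace E" "x' \<in> topspace E" for x x' a
    using g that by (auto simp: continuous_linear_def linear_on_def)
  have h_lin: "h (x + x') = h x + h x'" "h (t a x) = u a (h x)" if "x \<in> topspace F" "x' \<in> topspace F" for x x' a
    using h that by (auto simp: continuous_linear_def linear_on_def)
  have gc: "continuous_map (prod_topology E F) G (\<lambda>z. g (fst z))"
    and hc: "continuous_map (prod_topology E F) G (\<lambda>z. h (snd z))"
    using continuous_map_compose[OF continuous_map_fst, of E G g F]
      continuous_map_compose[OF continuous_map_snd, of F G h E] g h
    by (simp_all add: continuous_linear_def o_def)
  have "continuous_map (prod_topology E F) (prod_topology G G) (\<lambda>z. (g (fst z), h (snd z)))"
    using gc hc by (simp add: continuous_map_paired)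
  from continuous_map_compose[OF this G.continuous_add]
  have f_cont: "continuous_map (prod_topology E F) G ?f" by (simp add: o_def case_prod_unfold)
  have P_eq: "?P = subtopology (prod_topology E F) (Z \<times> topspace F)"
    using subtopology_Times[of E F Z "topspace F"] by simp
  have P_top: "topspace ?P = Z \<times> topspace F" using ZE by auto
  have f_W: "?f z \<in> W" if "z \<in> Z \<times> topspace F" for z
    using that gZ hF G.subspace_add[OF W(2)] by auto
  then have f: "continuous_map ?P ?Q ?f"
    unfolding P_eq by (auto simp: continuous_map_in_subtopology intro: continuous_map_from_subtopology[OF f_cont])
  have "k_space ?Q" by (rule k_space_closed_subtopology[OF G.complete_nuclear_DF_imp_k_space[OF G] W(1)])
  moreover have "Hausdorff_space ?Q" using G.hausdorff by (rule Hausdorff_space_subtopology)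
  moreover have "\<exists>B. compactin ?P B \<and> C \<subseteq> ?f ` B" if C: "compactin ?Q C" for C
  proof -
    obtain A :: "nat \<Rightarrow> 'a set" where A: "\<And>i. compactin E (A i)" "\<And>i. absolutely_convex s (A i)"
      "mono A" "\<And>C. tvs_bounded s E C \<Longrightarrow> \<exists>i. C \<subseteq> A i"
      using E.compact_exhaustion[OF E] by metis
    obtain D :: "nat \<Rightarrow> 'b set" where D: "\<And>i. compactin F (D i)" "\<And>i. absolutely_convex t (D i)"
      "mono D" "\<And>C. tvs_bounded t F C \<Longrightarrow> \<exists>i. C \<subseteq> D i"
      using F.compact_exhaustion[OF F] by metis
    obtain K :: "nat \<Rightarrow> 'c set" where K: "\<And>i. compactin G (K i)" "\<And>i. absolutely_convex u (K i)"
      "\<And>i. 0 \<in> K i" "\<And>C. tvs_bounded u G C \<Longrightarrow> \<exists>i. C \<subseteq> K i"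
      using G.compact_exhaustion[OF G] by metis
    have CG: "compactin G C" and CW: "C \<subseteq> W" using C by (simp_all add: compactin_subtopology)
    obtain m where m: "C \<subseteq> K m" using K(4)[OF G.compactin_imp_tvs_bounded[OF CG]] by blast
    have DT: "D i \<subseteq> topspace F" for i using D(1) compactin_subset_topspace by blast
    define I where "I i = ?f ` ((A i \<inter> Z) \<times> D i)" for i
    have AZ: "compactin E (A i \<inter> Z)" for i by (rule compact_Int_closedin[OF A(1) Z(1)])
    have I_closed: "closedin G (I i)" for i unfolding I_def
      by (intro compactin_imp_closedin[OF G.hausdorff] image_compactin[OF _ f_cont])
         (simp add: compactin_Times AZ D(1))
    have I_conv: "absolutely_convex u (I i)" for i
      unfolding absolutely_convex_def
    proof (intro ballI allI impI)
      fix x y and a b :: 'k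
      assume "x \<in> I i" "y \<in> I i" and ab: "norm a + norm b \<le> 1"
      then obtain p q p' q' where pq: "p \<in> A i" "p \<in> Z" "q \<in> D i" "p' \<in> A i" "p' \<in> Z" "q' \<in> D i"
        and xy: "x = g p + h q" "y = g p' + h q'" unfolding I_def by auto
      have T: "p \<in> topspace E" "p' \<in> topspace E" "q \<in> topspace F" "q' \<in> topspace F" using pq ZE DT by auto
      have "s a p + s b p' \<in> A i" "t a q + t b q' \<in> D i"
        using A(2)[of i] D(2)[of i] pq ab unfolding absolutely_convex_def by blast+
      moreover have "s a p + s b p' \<in> Z"
        using pq E.subspace_add[OF Z(2)] E.subspace_scale[OF Z(2)] by blast
      moreover have "u a x + u b y = g (s a p + s b p') + h (t a q + t b q')"
      proof -
        have "g (s a p + s b p') = u a (g p) + u b (g p')"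
          using g_lin T E.scale_in by metis
        moreover have "h (t a q + t b q') = u a (h q) + u b (h q')"
          using h_lin T F.scale_in by metis
        ultimately show ?thesis by (simp add: xy G.scale_right_distrib ac_simps)
      qed
      ultimately show "u a x + u b y \<in> I i" unfolding I_def
        by (intro image_eqI[where x = "(s a p + s b p', t a q + t b q')"]) auto
    qed
    have cover: "K m \<inter> W \<subseteq> (\<Union>i. I i)"
    proof
      fix w assume "w \<in> K m \<inter> W"
      then obtain x y where xy: "x \<in> Z" "y \<in> topspace F" "w = g x + h y" using surj by blast
      obtain i where i: "x \<in> A i" using A(4)[OF E.tvs_bounded_singleton] xy ZE by blast
      obtain j where j: "y \<in> D j" using D(4)[OF F.tvs_bounded_singleton] xy by blast
      have "x \<in> A (max i j)" "y \<in> D (max i j)"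
        using i j monoD[OF A(3), of i "max i j"] monoD[OF D(3), of j "max i j"] by auto
      then have "w \<in> I (max i j)" unfolding I_def using xy
        by (intro image_eqI[where x = "(x, y)"]) auto
      then show "w \<in> (\<Union>i. I i)" by blast
    qed
    have KW: "compactin G (K m \<inter> W)" by (rule compact_Int_closedin[OF K(1) W(1)])
    have "absolutely_convex u (K m \<inter> W)"
      unfolding absolutely_convex_def
    proof (intro ballI allI impI IntI)
      fix x y and a b :: 'k assume xy: "x \<in> K m \<inter> W" "y \<in> K m \<inter> W" "norm a + norm b \<le> 1"
      then show "u a x + u b y \<in> K m" using K(2)[of m] unfolding absolutely_convex_def by blast
      show "u a x + u b y \<in> W" using xy G.subspace_add[OF W(2)] G.subspace_scale[OF W(2)] by blast
    qed
    moreover have "0 \<in> K m \<inter> W" using K(3) G.subspace_0[OF W(2)] by blast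
    ultimately obtain i r where r: "r > 0" "\<And>x. x \<in> K m \<inter> W \<Longrightarrow> u (of_real r) x \<in> I i"
      using G.compact_absorbed_by_cover[OF KW _ _ I_closed I_conv cover] by blast
    define c :: 'k where "c = inverse (of_real r)"
    let ?B = "s c ` (A i \<inter> Z) \<times> t c ` D i"
    have "compactin (subtopology E Z) (s c ` (A i \<inter> Z))"
      by (rule E.compactin_dilation[OF AZ]) (use E.subspace_scale[OF Z(2)] in blast)
    moreover have "compactin F (t c ` D i)" by (rule image_compactin[OF D(1) F.continuous_map_dilation])
    ultimately have "compactin ?P ?B" by (simp add: compactin_Times)
    moreover have "C \<subseteq> ?f ` ?B"
    proof
      fix x assume "x \<in> C"
      then have "u (of_real r) x \<in> I i" using r(2) m CW by blast
      then obtain p q where pq: "p \<in> A i" "p \<in> Z" "q \<in> D i" "u (of_real r) x = g p + h q"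
        unfolding I_def by auto
      have T: "p \<in> topspace E" "q \<in> topspace F" using pq ZE DT by auto
      have "x = u c (u (of_real r) x)" using r(1) by (simp add: c_def)
      also have "\<dots> = g (s c p) + h (t c q)"
        unfolding pq(4) G.scale_right_distrib using g_lin(2)[OF T(1) T(1)] h_lin(2)[OF T(2) T(2)] by simp
      finally show "x \<in> ?f ` ?B" using pq by (intro image_eqI[where x = "(s c p, t c q)"]) auto
    qed
    ultimately show ?thesis by blast
  qed
  ultimately show ?thesis by (rule compact_lifting_imp_quotient_map[OF f])
qed


section \<open>Cohomology\<close>

lemma cohomology_class_eq_iff:
  assumes "cochain_complex s X d"
  shows "cohomology_class X d n x = cohomology_class X d n y \<longleftrightarrow> x - y \<in> coboundaries X d n"
proof -
  interpret L: locally_convex_space s "X k" for k using assms by (simp add: cochain_complex_def)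
  have add: "d (n - 1) (v + w) = d (n - 1) v + d (n - 1) w"
    if "v \<in> topspace (X (n - 1))" "w \<in> topspace (X (n - 1))" for v w
    using assms that by (simp add: cochain_complex_def continuous_linear_def linear_on_def)
  have B_add: "b + b' \<in> coboundaries X d n" if b: "b \<in> coboundaries X d n" "b' \<in> coboundaries X d n" for b b'
  proof -
    obtain v v' where v: "v \<in> topspace (X (n - 1))" "v' \<in> topspace (X (n - 1))" "b = d (n - 1) v" "b' = d (n - 1) v'"
      using b unfolding coboundaries_def by blast
    then have "b + b' = d (n - 1) (v + v')" using add by simp
    then show ?thesis using L.add_in[OF v(1,2)] unfolding coboundaries_def by blast
  qed
  have B_diff: "b - b' \<in> coboundaries X d n" if b: "b \<in> coboundaries X d n" "b' \<in> coboundaries X d n" for b b'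
  proof -
    obtain v v' where v: "v \<in> topspace (X (n - 1))" "v' \<in> topspace (X (n - 1))" "b = d (n - 1) v" "b' = d (n - 1) v'"
      using b unfolding coboundaries_def by blast
    have "b = d (n - 1) (v - v') + b'" using add[OF L.diff_in[OF v(1,2)] v(2)] v by simp
    then show ?thesis using L.diff_in[OF v(1,2)] unfolding coboundaries_def by auto
  qed
  have z: "0 \<in> coboundaries X d n" using B_diff L.zero_in[of "n - 1"] unfolding coboundaries_def by fastforce
  have mem: "w \<in> cohomology_class X d n v \<longleftrightarrow> w - v \<in> coboundaries X d n" for v w
    unfolding cohomology_class_def by (force simp: image_iff)
  show ?thesis
  proof
    assume "cohomology_class X d n x = cohomology_class X d n y"
    then show "x - y \<in> coboundaries X d n" using mem[of x x] mem[of x y] z by simp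
  next
    assume xy: "x - y \<in> coboundaries X d n"
    have "w - x \<in> coboundaries X d n \<longleftrightarrow> w - y \<in> coboundaries X d n" for w
      using B_add[OF _ xy, of "w - x"] B_diff[OF _ xy, of "w - y"] by auto
    then show "cohomology_class X d n x = cohomology_class X d n y" using mem by blast
  qed
qed

lemma cocycles_closed_subspace:
  assumes "cochain_complex s X d"
  shows "closedin (X n) (cocycles X d n)" "module.subspace s (cocycles X d n)"
proof -
  interpret L: locally_convex_space s "X k" for k using assms by (simp add: cochain_complex_def)
  have d: "continuous_map (X n) (X (n + 1)) (d n)" "linear_on s s (topspace (X n)) (d n)"
    using assms by (simp_all add: cochain_complex_def continuous_linear_def)
  have "closedin (X (n + 1)) {0}" by (rule closedin_Hausdorff_singleton[OF L.hausdorff L.zero_in])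
  from closedin_continuous_map_preimage[OF d(1) this]
  show "closedin (X n) (cocycles X d n)" by (simp add: cocycles_def)
  have "d n 0 = 0" using d(2) L.zero_in[of n] unfolding linear_on_def by (metis add_cancel_left_left)
  then show "module.subspace s (cocycles X d n)"
    using d(2) L.zero_in[of n] L.add_in[of _ n] L.scale_in[of _ n]
    by (auto simp: L.subspace_def cocycles_def linear_on_def)
qed

theorem corollary3p6:
  fixes scaleX :: "'k::real_normed_field \<Rightarrow> 'a::ab_group_add \<Rightarrow> 'a"
    and scaleY :: "'k \<Rightarrow> 'b::ab_group_add \<Rightarrow> 'b"
    and X :: "int \<Rightarrow> 'a topology" and dX :: "int \<Rightarrow> 'a \<Rightarrow> 'a"
    and Y :: "int \<Rightarrow> 'b topology" and dY :: "int \<Rightarrow> 'b \<Rightarrow> 'b"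
    and \<phi> :: "int \<Rightarrow> 'a \<Rightarrow> 'b" and n :: int
  assumes "cochain_complex scaleX X dX" and "\<And>k. complete_nuclear_DF_space scaleX (X k)"
    and "cochain_complex scaleY Y dY" and "\<And>k. complete_nuclear_DF_space scaleY (Y k)"
    and "cochain_morphism scaleX X dX scaleY Y dY \<phi>"
    and "cohomology_map Y dY \<phi> n ` topspace (cohomology X dX n) = topspace (cohomology Y dY n)"
  shows "open_map (cohomology X dX n) (cohomology Y dY n) (cohomology_map Y dY \<phi> n)"
proof -
  let ?Z = "cocycles X dX n" and ?W = "cocycles Y dY n"
  let ?clX = "cohomology_class X dX n" and ?clY = "cohomology_class Y dY n"
  let ?map = "cohomology_map Y dY \<phi> n"
  let ?P = "prod_topology (subtopology (X n) ?Z) (Y (n - 1))" and ?Q = "subtopology (Y n) ?W"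
  let ?f = "\<lambda>(x, y). \<phi> n x + dY (n - 1) y"
  interpret LX: locally_convex_space scaleX "X k" for k using assms(1) by (simp add: cochain_complex_def)
  interpret LY: locally_convex_space scaleY "Y k" for k using assms(3) by (simp add: cochain_complex_def)
  note Z = cocycles_closed_subspace[OF assms(1), of n] and W = cocycles_closed_subspace[OF assms(3), of n]
  have ZT: "?Z \<subseteq> topspace (X n)" and WT: "?W \<subseteq> topspace (Y n)" by (auto simp: cocycles_def)
  have \<phi>: "continuous_linear scaleX scaleY (X n) (Y n) (\<phi> n)"
    using assms(5) by (simp add: cochain_morphism_def)
  have dY: "continuous_linear scaleY scaleY (Y (n - 1)) (Y n) (dY (n - 1))"
    using assms(3) unfolding cochain_complex_def by (metis diff_add_cancel)
  have dY2: "dY n (dY (n - 1) y) = 0" if "y \<in> topspace (Y (n - 1))" for y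
    using assms(3) that unfolding cochain_complex_def by (metis diff_add_cancel)
  note map_class = cohomology_map_class(1)[OF assms(1,3,5)] and \<phi>_Z = cohomology_map_class(2)[OF assms(1,3,5)]
  note cl_eq = cohomology_class_eq_iff[OF assms(3), of n]
  have bd: "dY (n - 1) y \<in> coboundaries Y dY n" if "y \<in> topspace (Y (n - 1))" for y
    using that by (simp add: coboundaries_def)
  \<comment> \<open>Surjectivity on cohomology says that every cocycle of \<open>Y\<close> is a sum \<open>\<phi> x + dY y\<close>.\<close>
  have quot: "quotient_map ?P ?Q ?f"
  proof (rule sum_map_quotient_map[OF assms(2) assms(4) assms(4) \<phi> dY Z W])
    show "\<phi> n ` ?Z \<subseteq> ?W" using \<phi>_Z by blast
    show "dY (n - 1) ` topspace (Y (n - 1)) \<subseteq> ?W"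
      using dY dY2 by (auto simp: cocycles_def continuous_linear_def continuous_map_def)
    fix w assume w: "w \<in> ?W"
    then have "?clY w \<in> ?map ` (?clX ` ?Z)" using assms(6) by (simp add: topspace_cohomology)
    then obtain x where x: "x \<in> ?Z" "?clY w = ?clY (\<phi> n x)" using map_class by auto
    then obtain y where "y \<in> topspace (Y (n - 1))" "w - \<phi> n x = dY (n - 1) y"
      unfolding cl_eq coboundaries_def by blast
    then have "w = \<phi> n x + dY (n - 1) y" by (simp add: algebra_simps)
    then show "\<exists>x\<in>?Z. \<exists>y\<in>topspace (Y (n - 1)). w = \<phi> n x + dY (n - 1) y"
      using x(1) \<open>y \<in> _\<close> by blast
  qed
  show ?thesis
    unfolding open_map_def
  proof (intro allI impI)
    fix U assume U: "openin (cohomology X dX n) U"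
    have U_sub: "U \<subseteq> ?clX ` ?Z" using openin_subset[OF U] by (simp add: topspace_cohomology)
    have topZ: "topspace (subtopology (X n) ?Z) = ?Z" and topW: "topspace ?Q = ?W" using ZT WT by auto
    have U_open: "openin (subtopology (X n) ?Z) {x \<in> ?Z. ?clX x \<in> U}"
      using U unfolding cohomology_def openin_quotient_topology topZ by blast
    let ?S = "{x \<in> ?Z. ?clY (\<phi> n x) \<in> ?map ` U}"
    \<comment> \<open>\<open>?S\<close> is the union of the translates of the preimage of \<open>U\<close> by cocycles that map to coboundaries.\<close>
    have "openin (subtopology (X n) ?Z) ?S"
    proof (subst openin_subopen, intro ballI)
      fix x assume "x \<in> ?S"
      then obtain x' where x: "x \<in> ?Z" and x': "x' \<in> ?Z" "?clX x' \<in> U" "?clY (\<phi> n x) = ?clY (\<phi> n x')"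
        using U_sub map_class by (smt (verit) imageE mem_Collect_eq subsetD)
      define k where "k = x' - x"
      have k: "k \<in> ?Z" unfolding k_def by (rule LX.subspace_diff[OF Z(2) x'(1) x])
      let ?N = "{z \<in> ?Z. z + k \<in> {x \<in> ?Z. ?clX x \<in> U}}"
      have "continuous_map (subtopology (X n) ?Z) (subtopology (X n) ?Z) (\<lambda>z. z + k)"
        using continuous_map_from_subtopology[OF LX.continuous_map_translation] k ZT
          LX.subspace_add[OF Z(2) _ k]
        by (auto simp: continuous_map_in_subtopology)
      from openin_continuous_map_preimage[OF this U_open]
      have "openin (subtopology (X n) ?Z) ?N" unfolding topZ .
      moreover have "x \<in> ?N" using x x' by (simp add: k_def)
      moreover have "?N \<subseteq> ?S"
      proof
        fix z assume "z \<in> ?N"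
        then have z: "z \<in> ?Z" "z + k \<in> ?Z" "?clX (z + k) \<in> U" by auto
        have "\<phi> n (z + k) = \<phi> n z + \<phi> n k" "\<phi> n x' = \<phi> n x + \<phi> n k"
          using \<phi> z(1) k x ZT unfolding continuous_linear_def linear_on_def k_def
          by (metis (no_types, lifting) add.commute diff_add_cancel subsetD)+
        then have "\<phi> n z - \<phi> n (z + k) = \<phi> n x - \<phi> n x'" by simp
        then have "?clY (\<phi> n z) = ?clY (\<phi> n (z + k))" using x'(3) unfolding cl_eq by simp
        also have "\<dots> = ?map (?clX (z + k))" using map_class[OF z(2)] by simp
        finally show "z \<in> ?S" using z by simp
      qed
      ultimately show "\<exists>N. openin (subtopology (X n) ?Z) N \<and> x \<in> N \<and> N \<subseteq> ?S" by blast
    qed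
    then have "openin ?P (?S \<times> topspace (Y (n - 1)))" by (simp add: openin_prod_Times_iff)
    moreover have "?S \<times> topspace (Y (n - 1)) = {z \<in> topspace ?P. ?f z \<in> {w \<in> ?W. ?clY w \<in> ?map ` U}}"
    proof -
      have P_top: "topspace ?P = ?Z \<times> topspace (Y (n - 1))" using topZ by simp
      have "?f ` topspace ?P = ?W" using quotient_imp_surjective_map[OF quot] topW by simp
      then have f_W: "\<phi> n x + dY (n - 1) y \<in> ?W" if "x \<in> ?Z" "y \<in> topspace (Y (n - 1))" for x y
        using that unfolding P_top by (metis (no_types, lifting) SigmaI case_prod_conv imageI)
      have cl: "?clY (\<phi> n x + dY (n - 1) y) = ?clY (\<phi> n x)" if "y \<in> topspace (Y (n - 1))" for x y
        using bd[OF that] by (simp add: cl_eq)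
      show ?thesis unfolding P_top using f_W cl by auto
    qed
    ultimately have "openin ?P {z \<in> topspace ?P. ?f z \<in> {w \<in> ?W. ?clY w \<in> ?map ` U}}"
      by simp
    moreover have "{w \<in> ?W. ?clY w \<in> ?map ` U} \<subseteq> topspace ?Q" unfolding topW by blast
    ultimately have "openin ?Q {w \<in> ?W. ?clY w \<in> ?map ` U}"
      using quot[unfolded quotient_map_def, THEN conjunct2, rule_format] by blast
    moreover have "?map ` U \<subseteq> ?clY ` ?W"
      using image_mono[OF U_sub, of ?map] assms(6) by (simp add: topspace_cohomology)
    ultimately show "openin (cohomology Y dY n) (?map ` U)"
      unfolding cohomology_def openin_quotient_topology topW by blast
  qed
qed

end
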